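(* Let $p$ be a prime and let $G=\bigoplus_{i=1}^s G_i$ be a bounded abelian $p$-group with $G_i\cong(\mathbb Z_{p^{n_i}})^{r_i}$, $0<n_1<\cdots<n_s$. Suppose that $G$ is a (uas)-(ucs)-group for $\Delta(G)$. Then the nilpotency class $n(G)$ of $\Delta(G)$ is $$n(G)=\begin{cases} l(\mathcal J) & \text{if } r_s\ge 2,\\ y(G) & \text{if } r_s=1.\end{cases}$$
   Context: $\mathcal E=\operatorname{End}(G)$, $\mathcal J$ is its Jacobson radical, $\mathcal Z$ is the center of the ring $\mathcal E$, $\Delta(G)=1+\mathcal J$ is the maximal normal $p$-subgroup of $\operatorname{Aut}(G)$, and $Z=\mathcal Z\cap\Delta(G)$. Upper annihilating sequence of $\mathcal J$: $\mathcal J_0=0$, $\mathcal J_t=\{a\in\mathcal J: a\mathcal J\subseteq\mathcal J_{t-1},\ \mathcal J a\subseteq\mathcal J_{t-1}\}$ for $t\ge1$; $l(\mathcal J)$ is the least $d$ with $\mathcal J_d=\mathcal J$. $G$ is a (uas)-(ucs)-group for $\Delta(G)$ if the upper central series $(\mathcal Z_t)$ of $\Delta(G)$ satisfies $\mathcal Z_t=(\mathcal J_t+1)Z$ for all $t$ from $1$ to the nilpotency class of $\Delta(G)$. Upper function $\alpha(i,j,t)$ ($1\le i,j\le s$, $t\ge1$): $\alpha(s,s,1)=1$, $\alpha(i,j,1)=0$ for $(i,j)\ne(s,s)$, and for $t\ge2$, $\alpha(i,j,t)$ is the minimum of $n_j-n_{j-1}+\alpha(i,j-1,t-1)$, $n_i-n_{i-1}+\alpha(i-1,j,t-1)$,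 $\alpha(i,j,t-1)+1$, $\alpha(i+1,j,t-1)$, $\alpha(i,j+1,t-1)$, where terms involving an index outside $\{1,\dots,s\}$ are omitted. Let $f_{\mathcal J}(i,j)=n_{\min\{i,j\}}$ if $i\ne j$ and $f_{\mathcal J}(j,j)=n_j-1$. With $S=\{1,\dots,s\}$, $y(G)$ denotes the least $t$ such that $\alpha(i,j,t)\ge f_{\mathcal J}(i,j)$ for all $(i,j)\in S\times S\setminus\{(s,s)\}$.
   Formalization: The case where G has order p (s = 1, n_1 = 1, r_1 = 1) is excluded: there J = 0, so Δ(G) is trivial of class 0 and the (uas)-(ucs) condition is vacuous, while y(G) = 1 because α starts at t = 1. *)

theory Defs
  imports "HOL-Algebra.Algebra"
begin

section \<open>Endomorphism ring and Jacobson radical\<close>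

text \<open>
  Endomorphisms are represented by extensional functions, so that equality of elements of the ring
  is equality on \<open>carrier G\<close>; this is also the convention of \<open>AutoGroup\<close>.
  The group \<open>G\<close> is written multiplicatively.
\<close>

definition End_ring :: "('a, 'm) monoid_scheme \<Rightarrow> ('a \<Rightarrow> 'a) ring" where
  "End_ring G =
    \<lparr>carrier = hom G G \<inter> extensional (carrier G),
     monoid.mult = compose (carrier G),
     monoid.one = (\<lambda>x\<in>carrier G. x),
     ring.zero = (\<lambda>x\<in>carrier G. \<one>\<^bsub>G\<^esub>),
     ring.add = (\<lambda>f g. \<lambda>x\<in>carrier G. f x \<otimes>\<^bsub>G\<^esub> g x)\<rparr>"

lemma End_ring_ring:
  fixes G (structure)
  assumes "comm_group G"
  shows "ring (End_ring G)"
proof -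
  interpret comm_group G by fact
  have inv: "(\<lambda>x\<in>carrier G. inv (f x)) \<in> hom G G" if "f \<in> hom G G" for f
    using that by (auto simp: hom_def Pi_iff inv_mult)
  show ?thesis
  proof (rule ringI)
    show "abelian_group (End_ring G)"
    proof (rule abelian_groupI)
      fix f assume f: "f \<in> carrier (End_ring G)"
      show "\<exists>g\<in>carrier (End_ring G). g \<oplus>\<^bsub>End_ring G\<^esub> f = \<zero>\<^bsub>End_ring G\<^esub>"
        using f inv[of f]
        by (intro bexI[of _ "\<lambda>x\<in>carrier G. inv (f x)"])
           (auto simp: End_ring_def hom_def Pi_iff intro!: restrict_ext)
    qed (auto simp: End_ring_def hom_def Pi_iff m_ac fun_eq_iff restrict_def extensional_def)
    show "monoid (End_ring G)"
      by (rule monoidI)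
         (auto simp: End_ring_def hom_def Pi_iff compose_def fun_eq_iff restrict_def extensional_def)
  qed (auto simp: End_ring_def hom_def Pi_iff compose_def fun_eq_iff restrict_def extensional_def)
qed

definition left_ideal :: "'a set \<Rightarrow> ('a, 'm) ring_scheme \<Rightarrow> bool" where
  "left_ideal I R \<longleftrightarrow> additive_subgroup I R \<and>
     (\<forall>r\<in>carrier R. \<forall>x\<in>I. r \<otimes>\<^bsub>R\<^esub> x \<in> I)"

definition maximal_left_ideal :: "'a set \<Rightarrow> ('a, 'm) ring_scheme \<Rightarrow> bool" where
  "maximal_left_ideal M R \<longleftrightarrow> left_ideal M R \<and> M \<noteq> carrier R \<and>
     (\<forall>I. left_ideal I R \<longrightarrow> M \<subseteq> I \<longrightarrow> I = M \<or> I = carrier R)"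

definition jacobson_radical :: "('a, 'm) ring_scheme \<Rightarrow> 'a set" where
  "jacobson_radical R = {x \<in> carrier R. \<forall>M. maximal_left_ideal M R \<longrightarrow> x \<in> M}"

definition ring_center :: "('a, 'm) ring_scheme \<Rightarrow> 'a set" where
  "ring_center R = {z \<in> carrier R. \<forall>x\<in>carrier R. z \<otimes>\<^bsub>R\<^esub> x = x \<otimes>\<^bsub>R\<^esub> z}"

section \<open>Upper annihilating sequence\<close>

primrec upper_annihilating :: "('a, 'm) ring_scheme \<Rightarrow> 'a set \<Rightarrow> nat \<Rightarrow> 'a set" where
  "upper_annihilating R J 0 = {\<zero>\<^bsub>R\<^esub>}"
| "upper_annihilating R J (Suc t) =
     {a \<in> J. a <#\<^bsub>R\<^esub> J \<subseteq> upper_annihilating R J t \<and> J #>\<^bsub>R\<^esub> a \<subseteq> upper_annihilating R J t}"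

definition annihilating_length :: "('a, 'm) ring_scheme \<Rightarrow> 'a set \<Rightarrow> nat" where
  "annihilating_length R J = (LEAST d. upper_annihilating R J d = J)"

section \<open>Upper central series\<close>

primrec upper_central :: "('a, 'm) monoid_scheme \<Rightarrow> nat \<Rightarrow> 'a set" where
  "upper_central H 0 = {\<one>\<^bsub>H\<^esub>}"
| "upper_central H (Suc t) =
     {x \<in> carrier H. \<forall>y\<in>carrier H.
        inv\<^bsub>H\<^esub> x \<otimes>\<^bsub>H\<^esub> inv\<^bsub>H\<^esub> y \<otimes>\<^bsub>H\<^esub> x \<otimes>\<^bsub>H\<^esub> y \<in> upper_central H t}"

text \<open>In particular, the trivial group has nilpotency class \<open>0\<close>.\<close>

definition nilpotency_class :: "('a, 'm) monoid_scheme \<Rightarrow> nat" where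
  "nilpotency_class H = (LEAST c. upper_central H c = carrier H)"

section \<open>The group \<open>\<Delta>(G)\<close> and (uas)-(ucs)-groups\<close>

abbreviation End_radical :: "('a, 'm) monoid_scheme \<Rightarrow> ('a \<Rightarrow> 'a) set" where
  "End_radical G \<equiv> jacobson_radical (End_ring G)"

definition one_plus :: "('a, 'm) ring_scheme \<Rightarrow> 'a set \<Rightarrow> 'a set" where
  "one_plus R A = (\<lambda>a. \<one>\<^bsub>R\<^esub> \<oplus>\<^bsub>R\<^esub> a) ` A"

definition Delta :: "('a, 'm) monoid_scheme \<Rightarrow> ('a \<Rightarrow> 'a) monoid" where
  "Delta G = (AutoGroup G)\<lparr>carrier := one_plus (End_ring G) (End_radical G)\<rparr>"

definition uas_ucs_Delta :: "('a, 'm) monoid_scheme \<Rightarrow> bool" where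
  "uas_ucs_Delta G \<longleftrightarrow>
     (\<forall>t\<in>{1..nilpotency_class (Delta G)}.
        upper_central (Delta G) t =
          one_plus (End_ring G) (upper_annihilating (End_ring G) (End_radical G) t)
            <#>\<^bsub>Delta G\<^esub> (ring_center (End_ring G) \<inter> carrier (Delta G)))"

section \<open>Upper function\<close>

text \<open>
  The recursion starts at \<open>t = 1\<close>. The value at \<open>t = 0\<close> is a dummy which is never used.
  Singletons guarded by a condition implement the omission of terms with an index outside
  \<open>{1..s}\<close>. The differences are ordinary ones since \<open>n\<close> is increasing on \<open>{1..s}\<close>.
\<close>

fun upper_fun :: "(nat \<Rightarrow> nat) \<Rightarrow> nat \<Rightarrow> nat \<Rightarrow> nat \<Rightarrow> nat \<Rightarrow> nat" where
  "upper_fun n s i j 0 = 0"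
| "upper_fun n s i j (Suc 0) = (if i = s \<and> j = s then 1 else 0)"
| "upper_fun n s i j (Suc (Suc t)) =
     Min ((if 1 < j then {n j - n (j - 1) + upper_fun n s i (j - 1) (Suc t)} else {})
        \<union> (if 1 < i then {n i - n (i - 1) + upper_fun n s (i - 1) j (Suc t)} else {})
        \<union> {upper_fun n s i j (Suc t) + 1}
        \<union> (if i < s then {upper_fun n s (i + 1) j (Suc t)} else {})
        \<union> (if j < s then {upper_fun n s i (j + 1) (Suc t)} else {}))"

definition f_rad :: "(nat \<Rightarrow> nat) \<Rightarrow> nat \<Rightarrow> nat \<Rightarrow> nat" where
  "f_rad n i j = (if i = j then n j - 1 else n (min i j))"

definition y_bound :: "(nat \<Rightarrow> nat) \<Rightarrow> nat \<Rightarrow> nat" where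
  "y_bound n s = (LEAST t. 1 \<le> t \<and>
     (\<forall>(i, j) \<in> {1..s} \<times> {1..s} - {(s, s)}. f_rad n i j \<le> upper_fun n s i j t))"

end

(*
  Decompose G into cyclic summands and describe an endomorphism by its integer matrix. The
  Jacobson radical J consists of the matrices whose entries between summands of equal order are
  divisible by p, and the upper function records exactly the powers of p that annihilate the
  entries of the elements of J_t. If G is a (uas)-(ucs)-group, its class is the least t >= 1 with
  1 + J = (1 + J_t) Z, where Z consists of scalars. Off-diagonal entries are not affected by scalars
  up to units, and a scalar can correct the diagonal entry of at most one basis element, so the
  condition on t is that all entries but possibly one of top order are killed. Two basis elements
  of top order force J_t = J; a unique one yields the condition defining y(G).
*)
theory Submission
  imports Defs "HOL-Number_Theory.Cong"
begin

section \<open>The upper annihilating sequence of an ideal\<close>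

text \<open>The ranks r_i may be infinite, so an entry is a coordinate of the image of a basis
  element, meaningful only modulo the order of the target, and sums stay finite because elements of
  the group have finite support. The delicate point is the diagonal. If
  \<open>n_s - 1 \<le> \<alpha>(s,s,t)\<close>, then \<open>n_i - 1 \<le> \<alpha>(i,i,t)\<close> is
  needed on every lower level, but the growth estimates for the upper function lose
  \<open>n_s - n_i\<close> twice between (s,s) and (i,i). The way around is ring-theoretic:
  multiplication by p is central, and a central element of J lies in J_t as soon as its product with
  the projection onto one cyclic summand of top order does. If instead the bound fails at the top
  position and at another one, the diagonal entries of J_t vanish there modulo \<open>p^2\<close>,
  and a scalar would have to be \<open>1 + p\<close> and 1 at once modulo \<open>p^2\<close>. The
  (uas)-(ucs) condition starts at t = 1, so a trivial group 1 + J is treated apart. For r_s = 1 this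
  happens only for the group of order p, which is excluded: its class is 0, while y is at least
  1.\<close>

context ring
begin

lemma ideal_if_closed:
  assumes "I \<subseteq> carrier R" "\<zero> \<in> I"
    and "\<And>x y. x \<in> I \<Longrightarrow> y \<in> I \<Longrightarrow> x \<oplus> y \<in> I"
    and l: "\<And>r x. r \<in> carrier R \<Longrightarrow> x \<in> I \<Longrightarrow> r \<otimes> x \<in> I"
    and "\<And>r x. r \<in> carrier R \<Longrightarrow> x \<in> I \<Longrightarrow> x \<otimes> r \<in> I"
  shows "ideal I R"
proof (rule idealI)
  have "\<ominus> x \<in> I" if "x \<in> I" for x
    using l[of "\<ominus> \<one>" x] that assms(1) by (auto simp: l_minus)
  then show "subgroup I (add_monoid R)"
    using assms by (intro add.subgroupI) auto
qed (use assms ring_axioms in auto)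

lemma left_ideal_if_closed:
  assumes "I \<subseteq> carrier R" "\<zero> \<in> I"
    and "\<And>x y. x \<in> I \<Longrightarrow> y \<in> I \<Longrightarrow> x \<oplus> y \<in> I"
    and l: "\<And>r x. r \<in> carrier R \<Longrightarrow> x \<in> I \<Longrightarrow> r \<otimes> x \<in> I"
  shows "left_ideal I R"
proof -
  have "\<ominus> x \<in> I" if "x \<in> I" for x
    using l[of "\<ominus> \<one>" x] that assms(1) by (auto simp: l_minus)
  then have "subgroup I (add_monoid R)"
    using assms by (intro add.subgroupI) auto
  then show ?thesis
    using l by (simp add: left_ideal_def additive_subgroupI)
qed

lemma upper_annihilating_Suc_iff:
  "a \<in> upper_annihilating R J (Suc t) \<longleftrightarrow>
     a \<in> J \<and> (\<forall>x\<in>J. a \<otimes> x \<in> upper_annihilating R J t \<and> x \<otimes> a \<in> upper_annihilating R J t)"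
  by (auto simp: l_coset_def r_coset_def)

lemma upper_annihilating_subset:
  assumes "ideal J R"
  shows "upper_annihilating R J t \<subseteq> J"
proof -
  interpret J: ideal J R by fact
  show ?thesis by (cases t) auto
qed

lemma upper_annihilating_ideal:
  assumes "ideal J R"
  shows "ideal (upper_annihilating R J t) R"
proof (induction t)
  case 0
  then show ?case by (simp add: zeroideal)
next
  case (Suc t)
  interpret J: ideal J R by fact
  interpret I: ideal "upper_annihilating R J t" R by fact
  note carr = J.Icarr
  show ?case
  proof (rule ideal_if_closed)
    fix r x assume r: "r \<in> carrier R" and x: "x \<in> upper_annihilating R J (Suc t)"
    have "(r \<otimes> x) \<otimes> y \<in> upper_annihilating R J t \<and> y \<otimes> (r \<otimes> x) \<in> upper_annihilating R J t"
      and "(x \<otimes> r) \<otimes> y \<in> upper_annihilating R J t \<and> y \<otimes> (x \<otimes> r) \<in> upper_annihilating R J t"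
      if y: "y \<in> J" for y
    proof -
      \<comment> \<open>\<open>y \<otimes> r\<close> and \<open>r \<otimes> y\<close> are again in
        \<open>J\<close>, so every product reduces to \<open>x\<close> against \<open>J\<close>, up
        to an outer factor absorbed by the ideal of the previous level.\<close>
      have "r \<otimes> (x \<otimes> y) \<in> upper_annihilating R J t" "(y \<otimes> x) \<otimes> r \<in> upper_annihilating R J t"
        "(y \<otimes> r) \<otimes> x \<in> upper_annihilating R J t" "x \<otimes> (r \<otimes> y) \<in> upper_annihilating R J t"
        using x y r unfolding upper_annihilating_Suc_iff
        by (auto intro: I.I_l_closed I.I_r_closed J.I_l_closed J.I_r_closed)
      then show "(r \<otimes> x) \<otimes> y \<in> upper_annihilating R J t \<and> y \<otimes> (r \<otimes> x) \<in> upper_annihilating R J t"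
        and "(x \<otimes> r) \<otimes> y \<in> upper_annihilating R J t \<and> y \<otimes> (x \<otimes> r) \<in> upper_annihilating R J t"
        using x y r carr unfolding upper_annihilating_Suc_iff by (auto simp: m_assoc)
    qed
    then show "r \<otimes> x \<in> upper_annihilating R J (Suc t)" "x \<otimes> r \<in> upper_annihilating R J (Suc t)"
      using x r unfolding upper_annihilating_Suc_iff
      by (auto intro: J.I_l_closed J.I_r_closed)
  next
    fix x y assume "x \<in> upper_annihilating R J (Suc t)" "y \<in> upper_annihilating R J (Suc t)"
    then show "x \<oplus> y \<in> upper_annihilating R J (Suc t)"
      using carr unfolding upper_annihilating_Suc_iff by (auto simp: l_distr r_distr)
  qed (use carr in \<open>auto simp: upper_annihilating_Suc_iff simp del: upper_annihilating.simps\<close>)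
qed

text \<open>The solution is the series x - x a + x a^2 - ..., finite because each factor
  \<open>a\<close> lowers the level by one. The recursion subtracts the solution for
  \<open>x \<otimes> a\<close> from \<open>x\<close>.\<close>

lemma upper_annihilating_left_inverse:
  assumes J: "ideal J R" and a: "a \<in> J" and x: "x \<in> upper_annihilating R J t"
  shows "\<exists>y\<in>J. y \<otimes> (\<one> \<oplus> a) = x"
  using x
proof (induction t arbitrary: x)
  case 0
  interpret J: ideal J R by fact
  show ?case using 0 a J.Icarr by (intro bexI[of _ \<zero>]) auto
next
  case (Suc t)
  interpret J: ideal J R by fact
  have x: "x \<in> J" "x \<otimes> a \<in> upper_annihilating R J t"
    using Suc.prems a by (auto simp only: upper_annihilating_Suc_iff)
  then obtain y where y: "y \<in> J" "y \<otimes> (\<one> \<oplus> a) = x \<otimes> a" using Suc.IH by blast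
  have c: "a \<in> carrier R" "x \<in> carrier R" "y \<in> carrier R" using a x y J.Icarr by auto
  have "(x \<ominus> y) \<otimes> (\<one> \<oplus> a) = x \<otimes> (\<one> \<oplus> a) \<ominus> y \<otimes> (\<one> \<oplus> a)"
    using c by (simp add: a_minus_def l_distr l_minus)
  also have "x \<otimes> (\<one> \<oplus> a) = x \<oplus> x \<otimes> a" using c by (simp add: r_distr)
  also have "x \<oplus> x \<otimes> a \<ominus> y \<otimes> (\<one> \<oplus> a) = x" unfolding y using c by algebra
  finally show ?case
    using x y by (intro bexI[of _ "x \<ominus> y"]) (auto simp: a_minus_def)
qed

text \<open>If \<open>b \<otimes> (\<one> \<oplus> a) = \<ominus> a\<close>, the product collapses
  to \<open>\<one>\<close>. Left inverses are enough both for maximal left ideals and for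
  \<open>groupI\<close>.\<close>

lemma one_plus_left_inverse:
  assumes J: "ideal J R" and N: "upper_annihilating R J N = J" and a: "a \<in> J"
  obtains b where "b \<in> J" "(\<one> \<oplus> b) \<otimes> (\<one> \<oplus> a) = \<one>"
proof -
  interpret J: ideal J R by fact
  obtain b where b: "b \<in> J" "b \<otimes> (\<one> \<oplus> a) = \<ominus> a"
    using upper_annihilating_left_inverse[OF J a, of "\<ominus> a" N] N a by auto
  have "a \<in> carrier R" "b \<in> carrier R" using a b J.Icarr by auto
  then have "(\<one> \<oplus> b) \<otimes> (\<one> \<oplus> a) = (\<one> \<oplus> a) \<oplus> b \<otimes> (\<one> \<oplus> a)" by (simp add: l_distr)
  also have "\<dots> = \<one>" unfolding b using \<open>a \<in> carrier R\<close> by algebra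
  finally show ?thesis using b that by blast
qed

text \<open>If a maximal left ideal \<open>M\<close> missed \<open>x\<close>, then
  \<open>M + R x\<close> would be everything, so \<open>1 = m + r x\<close>, and
  \<open>m = 1 - r x\<close> would be a left invertible element of \<open>M\<close>.\<close>

lemma nilpotent_ideal_subset_jacobson_radical:
  assumes J: "ideal J R" and N: "upper_annihilating R J N = J"
  shows "J \<subseteq> jacobson_radical R"
proof
  fix x assume x: "x \<in> J"
  interpret J: ideal J R by fact
  have xc: "x \<in> carrier R" using x J.Icarr by auto
  have "x \<in> M" if M: "maximal_left_ideal M R" for M
  proof (rule ccontr)
    assume nx: "x \<notin> M"
    interpret M: additive_subgroup M R
      using M by (simp add: maximal_left_ideal_def left_ideal_def)
    have Ml: "r \<otimes> m \<in> M" if "r \<in> carrier R" "m \<in> M" for r m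
      using M that by (simp add: maximal_left_ideal_def left_ideal_def)
    note Mc = M.a_Hcarr
    let ?I = "{m \<oplus> r \<otimes> x | m r. m \<in> M \<and> r \<in> carrier R}"
    have "left_ideal ?I R"
    proof (rule left_ideal_if_closed)
      show "\<zero> \<in> ?I" using xc M.zero_closed by (intro CollectI exI[of _ \<zero>]) auto
      fix y z assume "y \<in> ?I" "z \<in> ?I"
      then obtain m r m' r' where *: "m \<in> M" "r \<in> carrier R" "y = m \<oplus> r \<otimes> x"
        "m' \<in> M" "r' \<in> carrier R" "z = m' \<oplus> r' \<otimes> x" by auto
      have mc: "m \<in> carrier R" "m' \<in> carrier R" using * Mc by auto
      have "y \<oplus> z = (m \<oplus> m') \<oplus> (r \<oplus> r') \<otimes> x"
        using * mc xc by (simp add: l_distr a_ac)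
      then show "y \<oplus> z \<in> ?I" using * M.a_closed by (auto intro!: exI)
    next
      fix r y assume "r \<in> carrier R" "y \<in> ?I"
      then obtain m r' where *: "m \<in> M" "r' \<in> carrier R" "y = m \<oplus> r' \<otimes> x" by auto
      have "r \<otimes> y = r \<otimes> m \<oplus> (r \<otimes> r') \<otimes> x"
        using * Mc[OF *(1)] xc \<open>r \<in> carrier R\<close> by (simp add: r_distr m_assoc)
      then show "r \<otimes> y \<in> ?I" using * Ml \<open>r \<in> carrier R\<close> by auto
    qed (use Mc xc in auto)
    moreover have "M \<subseteq> ?I"
    proof
      fix m assume "m \<in> M"
      then show "m \<in> ?I" using Mc xc by (intro CollectI exI[of _ m] exI[of _ \<zero>]) auto
    qed
    moreover have "x \<in> ?I"
      using M.zero_closed xc by (intro CollectI exI[of _ \<zero>] exI[of _ \<one>]) auto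
    ultimately have "?I = carrier R"
      using M nx unfolding maximal_left_ideal_def by blast
    then obtain m r where m: "m \<in> M" "r \<in> carrier R" "\<one> = m \<oplus> r \<otimes> x"
      by (smt (verit) mem_Collect_eq one_closed)
    have mc: "m \<in> carrier R" using m Mc by auto
    have "m = (m \<oplus> r \<otimes> x) \<oplus> \<ominus> (r \<otimes> x)" using mc m(2) xc by algebra
    then have meq: "m = \<one> \<oplus> \<ominus> (r \<otimes> x)" using m(3) by simp
    have "\<ominus> (r \<otimes> x) \<in> J" using x m J.I_l_closed by simp
    then obtain b where "b \<in> J" "(\<one> \<oplus> b) \<otimes> (\<one> \<oplus> \<ominus> (r \<otimes> x)) = \<one>"
      by (rule one_plus_left_inverse[OF J N])
    then have "b \<in> J" "(\<one> \<oplus> b) \<otimes> m = \<one>" using meq by simp_all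
    then have "\<one> \<in> M" using Ml[of "\<one> \<oplus> b" m] m(1) J.Icarr by simp
    then have "carrier R \<subseteq> M" using Ml[of _ \<one>] by fastforce
    then show False
      using M M.a_Hcarr unfolding maximal_left_ideal_def by blast
  qed
  then show "x \<in> jacobson_radical R" using xc by (simp add: jacobson_radical_def)
qed

end

text \<open>One-sided counterpart of the annihilating sequence: \<open>y\<close> is killed by every
  product of \<open>t\<close> factors from \<open>J\<close> on its left. Being one-sided, it can be
  tested after multiplications on the right.\<close>

primrec left_killed :: "('a, 'm) ring_scheme \<Rightarrow> 'a set \<Rightarrow> nat \<Rightarrow> 'a set" where
  "left_killed R J 0 = {\<zero>\<^bsub>R\<^esub>}"
| "left_killed R J (Suc t) = {y \<in> carrier R. \<forall>x\<in>J. x \<otimes>\<^bsub>R\<^esub> y \<in> left_killed R J t}"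

section \<open>Central elements: from annihilation on the left to annihilation on both sides\<close>

context ring
begin

lemma upper_annihilating_left_killed:
  assumes "ideal J R"
  shows "upper_annihilating R J t \<subseteq> left_killed R J t"
proof (induction t)
  case (Suc t)
  interpret J: ideal J R by fact
  show ?case
    using Suc J.Icarr by (auto simp: upper_annihilating_Suc_iff simp del: upper_annihilating.simps)
qed simp

lemma left_killed_l_closed:
  assumes "ideal J R" "y \<in> left_killed R J t" "g \<in> carrier R"
  shows "g \<otimes> y \<in> left_killed R J t"
proof (cases t)
  case (Suc u)
  interpret J: ideal J R by fact
  have "x \<otimes> (g \<otimes> y) \<in> left_killed R J u" if "x \<in> J" for x
  proof -
    have "(x \<otimes> g) \<otimes> y \<in> left_killed R J u"
      using assms that Suc by (simp add: J.I_r_closed)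
    then show ?thesis using assms Suc that J.Icarr by (simp add: m_assoc)
  qed
  then show ?thesis using assms Suc by simp
qed (use assms in simp)

text \<open>Left factors from \<open>J\<close> do not interfere with the right factors
  \<open>h\<close> and \<open>e\<close>, so the test passes through the recursion;
  \<open>faithful\<close> settles level 0.\<close>

lemma left_killed_faithful:
  assumes J: "ideal J R" and e: "e \<in> carrier R"
    and faithful: "\<And>y. y \<in> carrier R \<Longrightarrow> (\<And>h. h \<in> carrier R \<Longrightarrow> y \<otimes> h \<otimes> e = \<zero>) \<Longrightarrow> y = \<zero>"
    and "y \<in> carrier R" "\<And>h. h \<in> carrier R \<Longrightarrow> y \<otimes> h \<otimes> e \<in> left_killed R J t"
  shows "y \<in> left_killed R J t"
  using assms(4,5)
proof (induction t arbitrary: y)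
  case 0
  then show ?case using faithful by simp
next
  case (Suc t)
  interpret J: ideal J R by fact
  have "x \<otimes> y \<in> left_killed R J t" if "x \<in> J" for x
  proof (rule Suc.IH)
    fix h assume h: "h \<in> carrier R"
    have "x \<otimes> (y \<otimes> h \<otimes> e) \<in> left_killed R J t"
      using Suc.prems(2)[OF h] that by simp
    then show "x \<otimes> y \<otimes> h \<otimes> e \<in> left_killed R J t"
      using h Suc.prems(1) that J.Icarr e by (simp add: m_assoc)
  qed (use Suc.prems that J.Icarr in auto)
  then show ?case using Suc.prems by simp
qed

text \<open>Centrality lets all factors from \<open>J\<close>, on whichever side they stand, be
  collected to the left of \<open>z\<close>, so killing from the left is killing from both
  sides.\<close>

lemma central_left_killed_upper_annihilating:
  assumes J: "ideal J R" and z: "z \<in> ring_center R" "z \<in> J" "z \<in> left_killed R J N"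
  shows "z \<in> upper_annihilating R J N"
proof -
  interpret J: ideal J R by fact
  have zc: "z \<in> carrier R" "\<And>x. x \<in> carrier R \<Longrightarrow> z \<otimes> x = x \<otimes> z"
    using z by (auto simp: ring_center_def)
  \<comment> \<open>\<open>y\<close> plays the role of a product of \<open>m\<close> factors from \<open>J\<close>, on either side of \<open>z\<close>.\<close>
  have "z \<otimes> y \<in> upper_annihilating R J t"
    if "z \<in> left_killed R J (t + m)" "y \<in> carrier R"
      "\<And>u w. w \<in> left_killed R J (u + m) \<Longrightarrow> w \<in> carrier R \<Longrightarrow> y \<otimes> w \<in> left_killed R J u" for t m y
    using that
  proof (induction t arbitrary: m y)
    case 0
    then have "y \<otimes> z \<in> left_killed R J 0" using zc by blast
    then show ?case using zc 0 by simp
  next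
    case (Suc t)
    have zk: "z \<in> left_killed R J (t + Suc m)" using Suc.prems by simp
    have "z \<otimes> (y \<otimes> x) \<in> upper_annihilating R J t \<and> z \<otimes> (x \<otimes> y) \<in> upper_annihilating R J t"
      if x: "x \<in> J" for x
    proof (intro conjI; rule Suc.IH[OF zk])
      fix u w assume w: "w \<in> left_killed R J (u + Suc m)" "w \<in> carrier R"
      have "y \<otimes> (x \<otimes> w) \<in> left_killed R J u"
        using w x J.Icarr by (intro Suc.prems(3)) auto
      then show "y \<otimes> x \<otimes> w \<in> left_killed R J u"
        using w x J.Icarr Suc.prems by (simp add: m_assoc)
      have "y \<otimes> w \<in> left_killed R J (Suc u)"
        using w by (intro Suc.prems(3)) auto
      then have "x \<otimes> (y \<otimes> w) \<in> left_killed R J u" using x by simp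
      then show "x \<otimes> y \<otimes> w \<in> left_killed R J u"
        using w x J.Icarr Suc.prems by (simp add: m_assoc)
    qed (use x J.Icarr Suc.prems in auto)
    moreover have "z \<otimes> (y \<otimes> x) = z \<otimes> y \<otimes> x \<and> z \<otimes> (x \<otimes> y) = x \<otimes> (z \<otimes> y)" if "x \<in> J" for x
    proof -
      have x: "x \<in> carrier R" using that J.Icarr by auto
      have "z \<otimes> (x \<otimes> y) = (x \<otimes> z) \<otimes> y" using x zc Suc.prems by (simp flip: m_assoc)
      then show ?thesis using x zc(1) Suc.prems by (simp add: m_assoc)
    qed
    ultimately show ?case
      using z(2) Suc.prems(2) by (simp add: upper_annihilating_Suc_iff J.I_r_closed del: upper_annihilating.simps)
  qed
  \<comment> \<open>No factor has been collected yet: \<open>m = 0\<close> and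
    \<open>y = \<one>\<close>.\<close>
  from this[of N 0 \<one>] show ?thesis using z zc(1) by simp
qed

text \<open>The factors \<open>h\<close> can be moved past \<open>z\<close>, so \<open>z\<close> is
  tested on \<open>z \<otimes> e\<close> alone. Applied to multiplication by p, with
  \<open>e\<close> the projection onto a cyclic summand of top order.\<close>

lemma central_in_upper_annihilating:
  assumes J: "ideal J R" and z: "z \<in> ring_center R" "z \<in> J" and e: "e \<in> carrier R"
    and faithful: "\<And>y. y \<in> carrier R \<Longrightarrow> (\<And>h. h \<in> carrier R \<Longrightarrow> y \<otimes> h \<otimes> e = \<zero>) \<Longrightarrow> y = \<zero>"
    and ze: "z \<otimes> e \<in> upper_annihilating R J t"
  shows "z \<in> upper_annihilating R J t"
proof (rule central_left_killed_upper_annihilating[OF J z])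
  have zc: "z \<in> carrier R" "\<And>x. x \<in> carrier R \<Longrightarrow> z \<otimes> x = x \<otimes> z"
    using z by (auto simp: ring_center_def)
  show "z \<in> left_killed R J t"
  proof (rule left_killed_faithful[OF J e faithful])
    fix h assume h: "h \<in> carrier R"
    have "h \<otimes> (z \<otimes> e) \<in> left_killed R J t"
      using h ze upper_annihilating_left_killed[OF J] left_killed_l_closed[OF J] by blast
    moreover have "h \<otimes> (z \<otimes> e) = z \<otimes> h \<otimes> e"
      using h zc(1) zc(2)[OF h] e by (simp flip: m_assoc)
    ultimately show "z \<otimes> h \<otimes> e \<in> left_killed R J t" by simp
  qed (use zc in auto)
qed

text \<open>\<open>H\<close> stands for \<open>Delta G\<close>, whose product comes from
  \<open>AutoGroup\<close> and is specified only on bijections; hence agreement with the ring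
  product is asked for on the carrier alone.\<close>

lemma group_one_plus:
  fixes H :: "('a, 'k) monoid_scheme"
  assumes J: "ideal J R" and N: "upper_annihilating R J N = J"
    and H: "carrier H = one_plus R J" "\<one>\<^bsub>H\<^esub> = \<one>"
      "\<And>x y. x \<in> carrier H \<Longrightarrow> y \<in> carrier H \<Longrightarrow> x \<otimes>\<^bsub>H\<^esub> y = x \<otimes> y"
  shows "group H"
proof -
  interpret J: ideal J R by fact
  have carr: "x \<in> carrier R" if "x \<in> carrier H" for x
    using that H J.Icarr by (auto simp: one_plus_def)
  have mem: "\<one> \<oplus> a \<in> carrier H" if "a \<in> J" for a
    using that H by (auto simp: one_plus_def)
  have closed: "x \<otimes> y \<in> carrier H" if xy: "x \<in> carrier H" "y \<in> carrier H" for x y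
  proof -
    obtain a b where ab: "a \<in> J" "b \<in> J" "x = \<one> \<oplus> a" "y = \<one> \<oplus> b"
      using xy H by (auto simp: one_plus_def)
    note c = J.Icarr[OF ab(1)] J.Icarr[OF ab(2)]
    then have "x \<otimes> y = (\<one> \<oplus> a) \<oplus> (b \<oplus> a \<otimes> b)"
      unfolding ab(3,4) by (simp add: l_distr r_distr)
    also have "\<dots> = \<one> \<oplus> (a \<oplus> b \<oplus> a \<otimes> b)" using c by algebra
    finally have "x \<otimes> y = \<one> \<oplus> (a \<oplus> b \<oplus> a \<otimes> b)" .
    then show ?thesis using ab mem J.I_l_closed J.Icarr by auto
  qed
  show ?thesis
  proof (rule groupI)
    show "\<one>\<^bsub>H\<^esub> \<in> carrier H" using mem[of \<zero>] H by simp
    fix x assume x: "x \<in> carrier H"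
    then obtain a where a: "a \<in> J" "x = \<one> \<oplus> a" unfolding H(1) one_plus_def by blast
    from one_plus_left_inverse[OF J N a(1)] obtain b
      where "b \<in> J" "(\<one> \<oplus> b) \<otimes> (\<one> \<oplus> a) = \<one>" .
    then show "\<exists>y\<in>carrier H. y \<otimes>\<^bsub>H\<^esub> x = \<one>\<^bsub>H\<^esub>"
      using mem[of b] H(2,3) x a(2) by (intro bexI[of _ "\<one> \<oplus> b"]) simp_all
    have "\<one> \<in> carrier H" using mem[of \<zero>] by simp
    then show "\<one>\<^bsub>H\<^esub> \<otimes>\<^bsub>H\<^esub> x = x" using x carr H by simp
  qed (use closed H carr in \<open>auto simp: m_assoc\<close>)
qed

text \<open>For \<open>x = 1 + a\<close> and \<open>y = 1 + b\<close> one has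
  \<open>x y = y x + (a b - b a)\<close>, so the commutator is \<open>1 + u (a b - b a)\<close> with
  \<open>u\<close> the inverse of \<open>y x\<close>, and \<open>a b - b a\<close> is one level
  down. This makes \<open>Delta G\<close> nilpotent.\<close>

lemma one_plus_upper_annihilating_subset_upper_central:
  fixes H :: "('a, 'k) monoid_scheme"
  assumes J: "ideal J R" and N: "upper_annihilating R J N = J"
    and H: "carrier H = one_plus R J" "\<one>\<^bsub>H\<^esub> = \<one>"
      "\<And>x y. x \<in> carrier H \<Longrightarrow> y \<in> carrier H \<Longrightarrow> x \<otimes>\<^bsub>H\<^esub> y = x \<otimes> y"
  shows "one_plus R (upper_annihilating R J t) \<subseteq> upper_central H t"
proof (induction t)
  case 0
  then show ?case using H by (simp add: one_plus_def)
next
  case (Suc t)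
  interpret J: ideal J R by fact
  interpret H: group H by (rule group_one_plus[OF J N H])
  interpret I: ideal "upper_annihilating R J t" R by (rule upper_annihilating_ideal[OF J])
  have carr: "x \<in> carrier R" if "x \<in> carrier H" for x
    using that H J.Icarr by (auto simp: one_plus_def)
  have "inv\<^bsub>H\<^esub> x \<otimes>\<^bsub>H\<^esub> inv\<^bsub>H\<^esub> y \<otimes>\<^bsub>H\<^esub> x \<otimes>\<^bsub>H\<^esub> y \<in> upper_central H t"
    if x: "x \<in> one_plus R (upper_annihilating R J (Suc t))" and y: "y \<in> carrier H" for x y
  proof -
    obtain a where a: "a \<in> upper_annihilating R J (Suc t)" "x = \<one> \<oplus> a"
      using x by (auto simp: one_plus_def)
    obtain b where b: "b \<in> J" "y = \<one> \<oplus> b"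
      using y H by (auto simp: one_plus_def)
    have aJ: "a \<in> J" using a upper_annihilating_subset[OF J] by blast
    then have xH: "x \<in> carrier H" using a H by (auto simp: one_plus_def)
    have c: "a \<in> carrier R" "b \<in> carrier R" using aJ b J.Icarr by auto
    define u where "u = inv\<^bsub>H\<^esub> x \<otimes>\<^bsub>H\<^esub> inv\<^bsub>H\<^esub> y"
    have u: "u \<in> carrier H" "u \<in> carrier R" using xH y carr by (auto simp: u_def)
    have "u \<otimes>\<^bsub>H\<^esub> (y \<otimes>\<^bsub>H\<^esub> x) = \<one>\<^bsub>H\<^esub>"
      using xH y by (simp add: u_def H.m_assoc flip: H.m_assoc[of "inv\<^bsub>H\<^esub> y" y x])
    then have uyx: "u \<otimes> (y \<otimes> x) = \<one>" using u xH y H(2,3) H.m_closed by metis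
    have ab: "u \<otimes> (a \<otimes> b \<ominus> b \<otimes> a) \<in> upper_annihilating R J t"
      using a b u unfolding upper_annihilating_Suc_iff a_minus_def
      by (auto intro!: I.I_l_closed)
    have "inv\<^bsub>H\<^esub> x \<otimes>\<^bsub>H\<^esub> inv\<^bsub>H\<^esub> y \<otimes>\<^bsub>H\<^esub> x \<otimes>\<^bsub>H\<^esub> y = u \<otimes> (x \<otimes> y)"
      using u xH y H(3) H.m_closed by (metis H.m_assoc u_def)
    also have "x \<otimes> y = y \<otimes> x \<oplus> (a \<otimes> b \<ominus> b \<otimes> a)"
    proof -
      have "x \<otimes> y = \<one> \<oplus> (a \<oplus> b) \<oplus> a \<otimes> b" "y \<otimes> x = \<one> \<oplus> (a \<oplus> b) \<oplus> b \<otimes> a"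
        unfolding a(2) b(2) using c by (simp_all add: l_distr r_distr a_ac)
      then show ?thesis using c by algebra
    qed
    also have "u \<otimes> (y \<otimes> x \<oplus> (a \<otimes> b \<ominus> b \<otimes> a)) = \<one> \<oplus> u \<otimes> (a \<otimes> b \<ominus> b \<otimes> a)"
      using u c carr xH y uyx by (simp add: r_distr)
    finally show ?thesis using Suc ab by (auto simp: one_plus_def)
  qed
  moreover have "one_plus R (upper_annihilating R J (Suc t)) \<subseteq> carrier H"
    using upper_annihilating_subset[OF J, of "Suc t"] H(1) unfolding one_plus_def by blast
  ultimately show ?case by auto
qed

end

section \<open>The upper function\<close>

text \<open>\<open>p ^ step_weight n i j\<close> generates the homomorphisms from \<open>\<int>/p^(n i)\<close> to
  \<open>\<int>/p^(n j)\<close>, or the radical in case \<open>i = j\<close>.\<close>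

definition step_weight :: "(nat \<Rightarrow> nat) \<Rightarrow> nat \<Rightarrow> nat \<Rightarrow> nat" where
  "step_weight n i j = (if i = j then 1 else n j - n i)"

lemma strict_mono_gap:
  fixes n :: "nat \<Rightarrow> nat"
  assumes "strict_mono_on {1..s} n" "1 < i" "i \<le> s"
  shows "n (i - 1) < n i"
  using assms by (intro strict_mono_onD[OF assms(1)]) auto

text \<open>The dummy value at \<open>0\<close> makes the recursion hold from the start.\<close>

lemma upper_fun_Suc:
  assumes "strict_mono_on {1..s} n" "i \<in> {1..s}" "j \<in> {1..s}"
  shows "upper_fun n s i j (Suc t) =
     Min ((if 1 < j then {n j - n (j - 1) + upper_fun n s i (j - 1) t} else {})
        \<union> (if 1 < i then {n i - n (i - 1) + upper_fun n s (i - 1) j t} else {})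
        \<union> {upper_fun n s i j t + 1}
        \<union> (if i < s then {upper_fun n s (i + 1) j t} else {})
        \<union> (if j < s then {upper_fun n s i (j + 1) t} else {}))"
proof (cases t)
  case 0
  \<comment> \<open>At \<open>t = 0\<close> all earlier values are 0: away from
    \<open>(s, s)\<close> a term with a raised index gives 0, while at \<open>(s, s)\<close> only
    the term 1 and gaps of at least 1 remain.\<close>
  have "1 \<le> n k - n (k - 1)" if "1 < k" "k \<le> s" for k
    using strict_mono_gap[OF assms(1) that] by simp
  then show ?thesis
    using assms(2,3) 0 by (intro Min_eqI[symmetric]) (auto split: if_splits)
qed (simp only: upper_fun.simps)

lemma upper_fun_Suc_bounds:
  assumes "strict_mono_on {1..s} n" "i \<in> {1..s}" "j \<in> {1..s}"
  shows "1 < j \<Longrightarrow> upper_fun n s i j (Suc t) \<le> n j - n (j - 1) + upper_fun n s i (j - 1) t"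
    and "1 < i \<Longrightarrow> upper_fun n s i j (Suc t) \<le> n i - n (i - 1) + upper_fun n s (i - 1) j t"
    and "upper_fun n s i j (Suc t) \<le> upper_fun n s i j t + 1"
    and "i < s \<Longrightarrow> upper_fun n s i j (Suc t) \<le> upper_fun n s (i + 1) j t"
    and "j < s \<Longrightarrow> upper_fun n s i j (Suc t) \<le> upper_fun n s i (j + 1) t"
  unfolding upper_fun_Suc[OF assms] by (intro Min_le; simp)+

lemma upper_fun_Suc_greatest:
  assumes "strict_mono_on {1..s} n" "i \<in> {1..s}" "j \<in> {1..s}"
    and "1 < j \<Longrightarrow> m \<le> n j - n (j - 1) + upper_fun n s i (j - 1) t"
    and "1 < i \<Longrightarrow> m \<le> n i - n (i - 1) + upper_fun n s (i - 1) j t"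
    and "m \<le> upper_fun n s i j t + 1"
    and "i < s \<Longrightarrow> m \<le> upper_fun n s (i + 1) j t"
    and "j < s \<Longrightarrow> m \<le> upper_fun n s i (j + 1) t"
  shows "m \<le> upper_fun n s i j (Suc t)"
  unfolding upper_fun_Suc[OF assms(1-3)] using assms(4-) by (subst Min_ge_iff) auto

text \<open>Each term of the minimum is one multiplication by a generator of the radical: it costs a
  gap from the level below, 1 within the level, and 0 from the level above, where truncated
  subtraction makes \<open>step_weight\<close> vanish. The attaining term tells which generator to
  test with.\<close>

lemma upper_fun_Suc_attained:
  assumes "strict_mono_on {1..s} n" "i \<in> {1..s}" "j \<in> {1..s}"
  shows "\<exists>k\<in>{1..s}. upper_fun n s i j (Suc t) = upper_fun n s k j t + step_weight n k i
                \<or> upper_fun n s i j (Suc t) = upper_fun n s i k t + step_weight n k j"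
proof -
  have up: "n k - n (k + 1) = 0" if "1 \<le> k" "k < s" for k
    using strict_mono_gap[OF assms(1), of "k + 1"] that by simp
  let ?S = "(if 1 < j then {n j - n (j - 1) + upper_fun n s i (j - 1) t} else {})
        \<union> (if 1 < i then {n i - n (i - 1) + upper_fun n s (i - 1) j t} else {})
        \<union> {upper_fun n s i j t + 1}
        \<union> (if i < s then {upper_fun n s (i + 1) j t} else {})
        \<union> (if j < s then {upper_fun n s i (j + 1) t} else {})"
  have "upper_fun n s i j (Suc t) \<in> ?S"
    unfolding upper_fun_Suc[OF assms] by (rule Min_in) auto
  then consider
      "1 < j" "upper_fun n s i j (Suc t) = n j - n (j - 1) + upper_fun n s i (j - 1) t"
    | "1 < i" "upper_fun n s i j (Suc t) = n i - n (i - 1) + upper_fun n s (i - 1) j t"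
    | "upper_fun n s i j (Suc t) = upper_fun n s i j t + 1"
    | "i < s" "upper_fun n s i j (Suc t) = upper_fun n s (i + 1) j t"
    | "j < s" "upper_fun n s i j (Suc t) = upper_fun n s i (j + 1) t"
    by (auto split: if_splits)
  then show ?thesis
  proof cases
    case 1
    then show ?thesis using assms by (intro bexI[of _ "j - 1"]) (auto simp: step_weight_def)
  next
    case 2
    then show ?thesis using assms by (intro bexI[of _ "i - 1"]) (auto simp: step_weight_def)
  next
    case 3
    then show ?thesis using assms by (intro bexI[of _ i]) (auto simp: step_weight_def)
  next
    case 4
    then show ?thesis using assms up[of i] by (intro bexI[of _ "i + 1"]) (auto simp: step_weight_def)
  next
    case 5
    then show ?thesis using assms up[of j] by (intro bexI[of _ "j + 1"]) (auto simp: step_weight_def)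
  qed
qed

lemma upper_fun_sym:
  assumes "strict_mono_on {1..s} n" "i \<in> {1..s}" "j \<in> {1..s}"
  shows "upper_fun n s i j t = upper_fun n s j i t"
  using assms(2,3)
proof (induction t arbitrary: i j)
  case (Suc t)
  have "upper_fun n s i j (Suc t) \<le> upper_fun n s j i (Suc t)" if "i \<in> {1..s}" "j \<in> {1..s}" for i j
  proof (rule upper_fun_Suc_greatest[OF assms(1) that(2,1)])
    note bounds = upper_fun_Suc_bounds[OF assms(1) that, of t]
    show "upper_fun n s i j (Suc t) \<le> n i - n (i - 1) + upper_fun n s j (i - 1) t" if "1 < i"
      using bounds(2) that Suc.IH[of "i - 1" j] \<open>i \<in> {1..s}\<close> \<open>j \<in> {1..s}\<close> by force
    show "upper_fun n s i j (Suc t) \<le> n j - n (j - 1) + upper_fun n s (j - 1) i t" if "1 < j"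
      using bounds(1) that Suc.IH[of i "j - 1"] \<open>i \<in> {1..s}\<close> \<open>j \<in> {1..s}\<close> by force
    show "upper_fun n s i j (Suc t) \<le> upper_fun n s (j + 1) i t" if "j < s"
      using bounds(5) that Suc.IH[of i "j + 1"] \<open>i \<in> {1..s}\<close> \<open>j \<in> {1..s}\<close> by force
    show "upper_fun n s i j (Suc t) \<le> upper_fun n s j (i + 1) t" if "i < s"
      using bounds(4) that Suc.IH[of "i + 1" j] \<open>i \<in> {1..s}\<close> \<open>j \<in> {1..s}\<close> by force
    show "upper_fun n s i j (Suc t) \<le> upper_fun n s j i t + 1"
      using bounds(3) Suc.IH[of i j] that by simp
  qed
  then show ?case using Suc.prems by (intro antisym) auto
qed simp

text \<open>Growth between adjacent levels, obtained by comparing the recursion term by term; it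
  later replaces neighbours by arbitrary levels.\<close>

lemma upper_fun_mono_Lipschitz:
  assumes "strict_mono_on {1..s} n" "i \<in> {1..s}" "i < s" "j \<in> {1..s}"
  shows "upper_fun n s i j t \<le> upper_fun n s (i + 1) j t"
    and "upper_fun n s (i + 1) j t \<le> upper_fun n s i j t + (n (i + 1) - n i)"
  using assms(2-)
proof (induction t arbitrary: i j)
  case (Suc t)
  have gap: "n k < n (k + 1)" if "1 \<le> k" "k < s" for k
    using strict_mono_gap[OF assms(1), of "k + 1"] that by simp
  {
    case 1
    have ij: "i \<in> {1..s}" "i + 1 \<in> {1..s}" "j \<in> {1..s}" using 1 by auto
    show ?case
    proof (rule upper_fun_Suc_greatest[OF assms(1) ij(2,3)])
      assume j: "1 < j"
      then have "j - 1 \<in> {1..s}" using ij by auto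
      with j show "upper_fun n s i j (Suc t) \<le> n j - n (j - 1) + upper_fun n s (i + 1) (j - 1) t"
        using upper_fun_Suc_bounds(1)[OF assms(1) ij(1,3), of t] Suc.IH(1)[of i "j - 1"] 1 by auto
    next
      assume "j < s"
      then show "upper_fun n s i j (Suc t) \<le> upper_fun n s (i + 1) (j + 1) t"
        using upper_fun_Suc_bounds(5)[OF assms(1) ij(1,3), of t] Suc.IH(1)[of i "j + 1"] 1 by auto
    next
      assume "i + 1 < s"
      then show "upper_fun n s i j (Suc t) \<le> upper_fun n s (i + 1 + 1) j t"
        using upper_fun_Suc_bounds(4)[OF assms(1) ij(1,3), of t] Suc.IH(1)[of "i + 1" j] 1 by auto
    qed (use upper_fun_Suc_bounds(3,4)[OF assms(1) ij(1,3), of t] gap[of i] 1 in auto)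
  next
    case 2
    have ij: "i \<in> {1..s}" "i + 1 \<in> {1..s}" "j \<in> {1..s}" using 2 by auto
    \<comment> \<open>The gap is moved to the left so that \<open>upper_fun_Suc_greatest\<close>
      applies; \<open>A - g \<le> B\<close> and \<open>A \<le> B + g\<close> are equivalent for
      natural numbers.\<close>
    have "upper_fun n s (i + 1) j (Suc t) - (n (i + 1) - n i) \<le> upper_fun n s i j (Suc t)"
    proof (rule upper_fun_Suc_greatest[OF assms(1) ij(1,3)])
      assume j: "1 < j"
      then have "j - 1 \<in> {1..s}" using ij by auto
      with j show "upper_fun n s (i + 1) j (Suc t) - (n (i + 1) - n i)
                   \<le> n j - n (j - 1) + upper_fun n s i (j - 1) t"
        using upper_fun_Suc_bounds(1)[OF assms(1) ij(2,3) j, of t] Suc.IH(2)[of i "j - 1"] 2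
        by linarith
    next
      assume "j < s"
      then show "upper_fun n s (i + 1) j (Suc t) - (n (i + 1) - n i) \<le> upper_fun n s i (j + 1) t"
        using upper_fun_Suc_bounds(5)[OF assms(1) ij(2,3), of t] Suc.IH(2)[of i "j + 1"] 2 by auto
    next
      assume i: "1 < i"
      then have "i - 1 \<in> {1..s}" using ij by auto
      with i show "upper_fun n s (i + 1) j (Suc t) - (n (i + 1) - n i)
                   \<le> n i - n (i - 1) + upper_fun n s (i - 1) j t"
      proof -
        have "upper_fun n s (i + 1) j (Suc t) \<le> n (i + 1) - n i + upper_fun n s i j t"
          using upper_fun_Suc_bounds(2)[OF assms(1) ij(2,3), of t] i by simp
        moreover have "upper_fun n s i j t \<le> upper_fun n s (i - 1) j t + (n i - n (i - 1))"
          using Suc.IH(2)[of "i - 1" j] \<open>i - 1 \<in> {1..s}\<close> i 2 by simp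
        ultimately show ?thesis by linarith
      qed
    next
      show "upper_fun n s (i + 1) j (Suc t) - (n (i + 1) - n i) \<le> upper_fun n s (i + 1) j t"
        using upper_fun_Suc_bounds(3)[OF assms(1) ij(2,3), of t] gap[of i] 2 by auto
      show "upper_fun n s (i + 1) j (Suc t) - (n (i + 1) - n i) \<le> upper_fun n s i j t + 1"
        using upper_fun_Suc_bounds(2)[OF assms(1) ij(2,3), of t] 2 by auto
    qed
    then show ?case by simp
  }
qed simp_all

lemma upper_fun_mono:
  assumes "strict_mono_on {1..s} n" "i \<in> {1..s}" "i \<le> k" "k \<le> s" "j \<in> {1..s}"
  shows "upper_fun n s i j t \<le> upper_fun n s k j t"
    and "upper_fun n s k j t \<le> upper_fun n s i j t + (n k - n i)"
  using assms(3,4)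
proof (induction k rule: dec_induct)
  case (step k)
  {
    case 1
    then show ?case
      using step upper_fun_mono_Lipschitz(1)[OF assms(1), of k j t] assms by force
  next
    case 2
    have "n i \<le> n k" "n k \<le> n (k + 1)"
      using step 2 assms strict_mono_on_leD[OF assms(1)] by auto
    then show ?case
      using step 2 upper_fun_mono_Lipschitz(2)[OF assms(1), of k j t] assms by force
  }
qed auto

text \<open>A product in the ring may pass through any level \<open>k\<close>, not only a neighbour.
  For \<open>k\<close> above \<open>i\<close> the term at \<open>i + 1\<close> and monotonicity
  suffice; for \<open>k\<close> below \<open>i\<close> the gaps telescope to
  \<open>n i - n k\<close>.\<close>

lemma upper_fun_step:
  assumes "strict_mono_on {1..s} n" "i \<in> {1..s}" "j \<in> {1..s}" "k \<in> {1..s}"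
  shows "upper_fun n s i j (Suc t) \<le> upper_fun n s k j t + step_weight n k i"
    and "upper_fun n s j i (Suc t) \<le> upper_fun n s j k t + step_weight n k i"
proof -
  have *: "upper_fun n s i j (Suc t) \<le> upper_fun n s k j t + step_weight n k i"
  proof (cases i k rule: linorder_cases)
    case less
    then show ?thesis
      using upper_fun_Suc_bounds(4)[OF assms(1-3), of t]
        upper_fun_mono(1)[OF assms(1), of "i + 1" k j t] assms by simp
  next
    case equal
    then show ?thesis using upper_fun_Suc_bounds(3)[OF assms(1-3), of t] by (simp add: step_weight_def)
  next
    case greater
    have "i - 1 \<in> {1..s}" "k \<le> i - 1" using greater assms by auto
    moreover from this have "n k \<le> n (i - 1)" "n (i - 1) \<le> n i"
      using greater assms by (auto intro!: strict_mono_on_leD[OF assms(1)])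
    moreover have "1 < i" "step_weight n k i = n i - n k"
      using greater assms by (auto simp: step_weight_def)
    moreover have "upper_fun n s (i - 1) j t \<le> upper_fun n s k j t + (n (i - 1) - n k)"
      using upper_fun_mono(2)[OF assms(1,4), of "i - 1" j t] calculation assms(3) by simp
    ultimately show ?thesis
      using upper_fun_Suc_bounds(2)[OF assms(1-3), of t] by linarith
  qed
  then show "upper_fun n s i j (Suc t) \<le> upper_fun n s k j t + step_weight n k i" .
  show "upper_fun n s j i (Suc t) \<le> upper_fun n s j k t + step_weight n k i"
    using * upper_fun_sym[OF assms(1)] assms by metis
qed

text \<open>Along every term of the recursion \<open>2 * upper_fun n s i j t - i - j\<close> grows
  by at least 1: either an index is raised, or the value gains at least 1 while at most one index
  drops by 1. Hence the values tend to infinity, which makes the radical nilpotent.\<close>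

lemma upper_fun_lower_bound:
  assumes "strict_mono_on {1..s} n" "i \<in> {1..s}" "j \<in> {1..s}"
  shows "t + i + j \<le> 2 * upper_fun n s i j t + 2 * s"
  using assms(2,3)
proof (induction t arbitrary: i j)
  case (Suc t)
  have gap: "1 < k \<Longrightarrow> n (k - 1) < n k" if "k \<le> s" for k
    using strict_mono_gap[OF assms(1), of "k"] that by simp
  \<comment> \<open>Half rounded up: the least value that the claim allows.\<close>
  have "(Suc t + i + j + 1) div 2 - s \<le> upper_fun n s i j (Suc t)"
  proof (rule upper_fun_Suc_greatest[OF assms(1) Suc.prems])
    assume j: "1 < j"
    then have "j - 1 \<in> {1..s}" using Suc.prems by auto
    with j show "(Suc t + i + j + 1) div 2 - s \<le> n j - n (j - 1) + upper_fun n s i (j - 1) t"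
      using Suc.IH[of i "j - 1"] gap[of j] Suc.prems by force
  next
    assume i: "1 < i"
    then have "i - 1 \<in> {1..s}" using Suc.prems by auto
    with i show "(Suc t + i + j + 1) div 2 - s \<le> n i - n (i - 1) + upper_fun n s (i - 1) j t"
      using Suc.IH[of "i - 1" j] gap[of i] Suc.prems by force
  next
    show "(Suc t + i + j + 1) div 2 - s \<le> upper_fun n s i j t + 1"
      using Suc.IH[of i j] Suc.prems by auto
  next
    assume "i < s" then show "(Suc t + i + j + 1) div 2 - s \<le> upper_fun n s (i + 1) j t"
      using Suc.IH[of "i + 1" j] Suc.prems by auto
  next
    assume "j < s" then show "(Suc t + i + j + 1) div 2 - s \<le> upper_fun n s i (j + 1) t"
      using Suc.IH[of i "j + 1"] Suc.prems by auto
  qed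
  then show ?case by linarith
qed simp

section \<open>Endomorphisms in coordinates\<close>

lemma cong_dvd_mult_iff:
  fixes x y m k q :: int
  assumes "[x = y] (mod m)" "k dvd m"
  shows "k dvd q * x \<longleftrightarrow> k dvd q * y"
  using assms by (meson cong_dvd_iff cong_dvd_modulus cong_scalar_left)

lemma End_ring_carrierD:
  assumes "f \<in> carrier (End_ring G)"
  shows "x \<in> carrier G \<Longrightarrow> f x \<in> carrier G"
    and "x \<in> carrier G \<Longrightarrow> y \<in> carrier G \<Longrightarrow> f (x \<otimes>\<^bsub>G\<^esub> y) = f x \<otimes>\<^bsub>G\<^esub> f y"
    and "f \<in> hom G G" "f \<in> extensional (carrier G)"
  using assms by (auto simp: End_ring_def hom_def)

lemma End_ring_apply:
  assumes "x \<in> carrier G"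
  shows "(f \<otimes>\<^bsub>End_ring G\<^esub> g) x = f (g x)"
    and "(f \<oplus>\<^bsub>End_ring G\<^esub> g) x = f x \<otimes>\<^bsub>G\<^esub> g x"
    and "\<one>\<^bsub>End_ring G\<^esub> x = x" "\<zero>\<^bsub>End_ring G\<^esub> x = \<one>\<^bsub>G\<^esub>"
  using assms by (auto simp: End_ring_def compose_def)

lemma End_ring_ext:
  assumes "f \<in> carrier (End_ring G)" "g \<in> carrier (End_ring G)"
    and "\<And>x. x \<in> carrier G \<Longrightarrow> f x = g x"
  shows "f = g"
  using assms by (auto simp: End_ring_def intro: extensionalityI)

text \<open>\<open>\<kappa> c\<close> are coordinates of the abelian group \<open>G\<close>, well defined modulo the order
  of the basis element \<open>b c\<close>, which is \<open>p ^ n (lev c)\<close>.\<close>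

locale p_group_basis = comm_group G for G (structure) +
  fixes p s :: nat and n :: "nat \<Rightarrow> nat" and C :: "'c set" and lev :: "'c \<Rightarrow> nat"
    and \<kappa> :: "'c \<Rightarrow> 'a \<Rightarrow> int" and b :: "'c \<Rightarrow> 'a"
  assumes prime_p: "Factorial_Ring.prime p"
    and s_ge_1: "1 \<le> s" and n1_pos: "0 < n 1" and n_mono: "strict_mono_on {1..s} n"
    and lev_image: "lev ` C = {1..s}"
    and b_carrier: "c \<in> C \<Longrightarrow> b c \<in> carrier G"
    and \<kappa>_mult: "c \<in> C \<Longrightarrow> x \<in> carrier G \<Longrightarrow> y \<in> carrier G
      \<Longrightarrow> [\<kappa> c (x \<otimes> y) = \<kappa> c x + \<kappa> c y] (mod int p ^ n (lev c))"
    and \<kappa>_b: "c \<in> C \<Longrightarrow> d \<in> C \<Longrightarrow> [\<kappa> c (b d) = (if c = d then 1 else 0)] (mod int p ^ n (lev c))"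
    and \<kappa>_finite: "x \<in> carrier G \<Longrightarrow> finite {c \<in> C. \<not> int p ^ n (lev c) dvd \<kappa> c x}"
    and \<kappa>_eq_one: "x \<in> carrier G \<Longrightarrow> (\<And>c. c \<in> C \<Longrightarrow> int p ^ n (lev c) dvd \<kappa> c x) \<Longrightarrow> x = \<one>"
begin

abbreviation Q :: "'c \<Rightarrow> int" where
  "Q c \<equiv> int p ^ n (lev c)"

abbreviation E :: "('a \<Rightarrow> 'a) ring" where
  "E \<equiv> End_ring G"

abbreviation wt :: "'c \<Rightarrow> 'c \<Rightarrow> nat" where
  "wt c d \<equiv> step_weight n (lev c) (lev d)"

abbreviation \<alpha> :: "'c \<Rightarrow> 'c \<Rightarrow> nat \<Rightarrow> nat" where
  "\<alpha> c d t \<equiv> upper_fun n s (lev c) (lev d) t"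

sublocale E: ring E
  by (rule End_ring_ring) (rule comm_group_axioms)

lemma p_gt_1: "1 < int p"
  using prime_gt_1_nat[OF prime_p] by simp

lemma prime_int_p: "Factorial_Ring.prime (int p)"
  using prime_p by simp

lemma lev_in: "c \<in> C \<Longrightarrow> lev c \<in> {1..s}"
  using lev_image by blast

lemma n_pos: "c \<in> C \<Longrightarrow> 0 < n (lev c)"
  using strict_mono_on_leD[OF n_mono, of 1 "lev c"] lev_in[of c] s_ge_1 n1_pos by auto

lemma p_dvd_Q: "c \<in> C \<Longrightarrow> int p dvd Q c"
  using n_pos by (metis dvd_power)

lemma n_eq_iff: "c \<in> C \<Longrightarrow> d \<in> C \<Longrightarrow> n (lev c) = n (lev d) \<longleftrightarrow> lev c = lev d"
  using strict_mono_on_eqD[OF n_mono] lev_in by metis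

lemma n_le_iff: "c \<in> C \<Longrightarrow> d \<in> C \<Longrightarrow> n (lev c) \<le> n (lev d) \<longleftrightarrow> lev c \<le> lev d"
  using strict_mono_on_leD[OF n_mono] strict_mono_onD[OF n_mono] lev_in by (metis leD leI)

text \<open>Off the diagonal both sides are the larger of the two exponents. Used to trade a
  divisibility modulo \<open>Q c\<close> for one modulo \<open>Q d\<close>.\<close>

lemma wt_swap:
  assumes "c \<in> C" "d \<in> C"
  shows "wt c d + n (lev c) = wt d c + n (lev d)"
  using n_eq_iff[OF assms] by (auto simp: step_weight_def)

lemma ex_lev: "i \<in> {1..s} \<Longrightarrow> \<exists>c\<in>C. lev c = i"
  using lev_image by (metis imageE)

subsection \<open>Coordinates\<close>

lemma \<kappa>_one: "c \<in> C \<Longrightarrow> [\<kappa> c \<one> = 0] (mod Q c)"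
  using \<kappa>_mult[of c \<one> \<one>] by (simp add: cong_iff_dvd_diff)

lemma \<kappa>_inv:
  assumes "c \<in> C" "x \<in> carrier G"
  shows "[\<kappa> c (inv x) = - \<kappa> c x] (mod Q c)"
proof -
  have "[\<kappa> c x + \<kappa> c (inv x) = 0] (mod Q c)"
    using cong_trans[OF cong_sym[OF \<kappa>_mult[of c x "inv x"]], of 0] \<kappa>_one[of c] assms by simp
  then show ?thesis by (simp add: cong_iff_dvd_diff add.commute)
qed

lemma \<kappa>_nat_pow:
  assumes "c \<in> C" "x \<in> carrier G"
  shows "[\<kappa> c (x [^] (k::nat)) = int k * \<kappa> c x] (mod Q c)"
proof (induction k)
  case 0
  then show ?case using \<kappa>_one assms by simp
next
  case (Suc k)
  have "[\<kappa> c (x [^] Suc k) = \<kappa> c (x [^] k) + \<kappa> c x] (mod Q c)"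
    using \<kappa>_mult[of c "x [^] k" x] assms by simp
  also have "[\<kappa> c (x [^] k) + \<kappa> c x = int k * \<kappa> c x + \<kappa> c x] (mod Q c)"
    using Suc by (rule cong_add) simp
  finally show ?case by (simp add: algebra_simps)
qed

lemma \<kappa>_int_pow:
  assumes "c \<in> C" "x \<in> carrier G"
  shows "[\<kappa> c (x [^] (k::int)) = k * \<kappa> c x] (mod Q c)"
proof (cases "0 \<le> k")
  case True
  then have "x [^] k = x [^] nat k" by (subst int_pow_def2) simp
  moreover have "int (nat k) = k" using True by simp
  ultimately show ?thesis using \<kappa>_nat_pow[OF assms, of "nat k"] by argo
next
  case False
  have "[\<kappa> c (inv (x [^] nat (- k))) = - \<kappa> c (x [^] nat (- k))] (mod Q c)"
    using \<kappa>_inv assms by simp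
  also have "[- \<kappa> c (x [^] nat (- k)) = - (int (nat (- k)) * \<kappa> c x)] (mod Q c)"
    unfolding cong_minus_minus_iff by (rule \<kappa>_nat_pow[OF assms])
  finally have "[\<kappa> c (inv (x [^] nat (- k))) = - (int (nat (- k)) * \<kappa> c x)] (mod Q c)" .
  moreover have "x [^] k = inv (x [^] nat (- k))" "- int (nat (- k)) = k"
    using False by (simp_all add: int_pow_def2[of G x k])
  ultimately show ?thesis by (metis mult_minus_left)
qed

lemma \<kappa>_finprod:
  assumes "finite F" "f \<in> F \<rightarrow> carrier G" "c \<in> C"
  shows "[\<kappa> c (finprod G f F) = (\<Sum>i\<in>F. \<kappa> c (f i))] (mod Q c)"
  using assms
proof (induction F rule: finite_induct)
  case empty
  then show ?case using \<kappa>_one by simp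
next
  case (insert i F)
  have "[\<kappa> c (finprod G f (insert i F)) = \<kappa> c (f i) + \<kappa> c (finprod G f F)] (mod Q c)"
    using \<kappa>_mult[of c "f i" "finprod G f F"] insert by (simp add: Pi_iff)
  also have "[\<kappa> c (f i) + \<kappa> c (finprod G f F) = \<kappa> c (f i) + (\<Sum>i\<in>F. \<kappa> c (f i))] (mod Q c)"
    using insert by (intro cong_add) auto
  finally show ?case using insert by simp
qed

lemma eq_if_\<kappa>_cong:
  assumes "x \<in> carrier G" "y \<in> carrier G" "\<And>c. c \<in> C \<Longrightarrow> [\<kappa> c x = \<kappa> c y] (mod Q c)"
  shows "x = y"
proof -
  have "x \<otimes> inv y = \<one>"
  proof (rule \<kappa>_eq_one)
    fix c assume c: "c \<in> C"
    have "[\<kappa> c (x \<otimes> inv y) = \<kappa> c x + \<kappa> c (inv y)] (mod Q c)"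
      using \<kappa>_mult c assms by simp
    also have "[\<kappa> c x + \<kappa> c (inv y) = \<kappa> c y + - \<kappa> c y] (mod Q c)"
      using assms c \<kappa>_inv by (intro cong_add) auto
    finally show "Q c dvd \<kappa> c (x \<otimes> inv y)" by (simp add: cong_0_iff)
  qed (use assms in auto)
  then show ?thesis using assms by (metis inv_closed inv_inv inv_equality)
qed

lemma pow_exponent_one:
  assumes "x \<in> carrier G" "\<And>c. c \<in> C \<Longrightarrow> Q c dvd k * \<kappa> c x"
  shows "x [^] (k::int) = \<one>"
proof (rule \<kappa>_eq_one)
  fix c assume c: "c \<in> C"
  then show "Q c dvd \<kappa> c (x [^] k)"
    using cong_dvd_mult_iff[OF \<kappa>_int_pow[OF c assms(1), of k] dvd_refl, of 1] assms(2) by simp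
qed (use assms in auto)

lemma b_pow_one:
  assumes "c \<in> C" "Q c dvd k"
  shows "b c [^] (k::int) = \<one>"
proof (rule pow_exponent_one)
  fix d assume d: "d \<in> C"
  show "Q d dvd k * \<kappa> d (b c)"
    using \<kappa>_b[OF d assms(1)] assms(2) by (cases "c = d") (auto simp: cong_0_iff)
qed (use assms b_carrier in auto)

lemma pow_cong:
  assumes "y \<in> carrier G" "y [^] (m::int) = \<one>" "[k = l] (mod m)"
  shows "y [^] (k::int) = y [^] l"
proof -
  obtain r where "k = l + m * r" using assms(3) by (metis cong_iff_lin cong_sym)
  then have "y [^] k = y [^] l \<otimes> (y [^] m) [^] r"
    using assms(1) by (simp add: int_pow_mult int_pow_pow)
  then show ?thesis using assms by simp
qed

lemma coordinate_expansion:
  assumes x: "x \<in> carrier G"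
  shows "x = (\<Otimes>c\<in>{c \<in> C. \<not> Q c dvd \<kappa> c x}. b c [^] \<kappa> c x)"
proof -
  define F where "F = {c \<in> C. \<not> Q c dvd \<kappa> c x}"
  have F: "finite F" "F \<subseteq> C" using \<kappa>_finite[OF x] by (auto simp: F_def)
  have "x = (\<Otimes>c\<in>F. b c [^] \<kappa> c x)"
  proof (rule eq_if_\<kappa>_cong)
    fix d assume d: "d \<in> C"
    have "[\<kappa> d (\<Otimes>c\<in>F. b c [^] \<kappa> c x) = (\<Sum>c\<in>F. \<kappa> d (b c [^] \<kappa> c x))] (mod Q d)"
      using F d b_carrier by (intro \<kappa>_finprod) auto
    also have "[(\<Sum>c\<in>F. \<kappa> d (b c [^] \<kappa> c x)) = (\<Sum>c\<in>F. \<kappa> c x * (if d = c then 1 else 0))] (mod Q d)"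
    proof (rule cong_sum)
      fix c assume "c \<in> F"
      then have c: "c \<in> C" using F by blast
      show "[\<kappa> d (b c [^] \<kappa> c x) = \<kappa> c x * (if d = c then 1 else 0)] (mod Q d)"
        using \<kappa>_int_pow[OF d b_carrier[OF c]] \<kappa>_b[OF d c] cong_scalar_left cong_trans by blast
    qed
    also have "(\<Sum>c\<in>F. \<kappa> c x * (if d = c then 1 else 0)) = (if d \<in> F then \<kappa> d x else 0)"
      using F by (simp add: if_distrib cong: if_cong)
    also have "[(if d \<in> F then \<kappa> d x else 0) = \<kappa> d x] (mod Q d)"
      using d by (auto simp: F_def cong_0_iff cong_sym_eq[of 0])
    finally show "[\<kappa> d x = \<kappa> d (\<Otimes>c\<in>F. b c [^] \<kappa> c x)] (mod Q d)" by (rule cong_sym)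
  qed (use F b_carrier x in \<open>auto intro!: finprod_closed\<close>)
  then show ?thesis by (simp add: F_def)
qed

lemma End_int_pow:
  assumes "f \<in> carrier E" "x \<in> carrier G"
  shows "f (x [^] (k::int)) = f x [^] k"
  using assms hom_int_pow[of f G G x k] End_ring_carrierD(3) is_group by blast

lemma End_finprod:
  assumes f: "f \<in> carrier E" and "finite F" "g \<in> F \<rightarrow> carrier G"
  shows "f (finprod G g F) = (\<Otimes>i\<in>F. f (g i))"
  using assms(2,3)
proof (induction F rule: finite_induct)
  case empty
  then show ?case
    using hom_one[OF End_ring_carrierD(3)[OF f] is_group is_group] by simp
next
  case (insert i F)
  then show ?case
    using f by (simp add: Pi_iff End_ring_carrierD)
qed

text \<open>Plays the role of matrix times vector. The sum runs over the finite support of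
  \<open>x\<close>, so \<open>C\<close> may be infinite; the other basis elements occur in
  \<open>x\<close> with trivial powers.\<close>

lemma entry_expansion:
  assumes f: "f \<in> carrier E" and x: "x \<in> carrier G" and d: "d \<in> C"
  shows "[\<kappa> d (f x) = (\<Sum>c\<in>{c \<in> C. \<not> Q c dvd \<kappa> c x}. \<kappa> c x * \<kappa> d (f (b c)))] (mod Q d)"
proof -
  define F where "F = {c \<in> C. \<not> Q c dvd \<kappa> c x}"
  have F: "finite F" "F \<subseteq> C" using \<kappa>_finite[OF x] by (auto simp: F_def)
  have "f x = f (\<Otimes>c\<in>F. b c [^] \<kappa> c x)"
    using coordinate_expansion[OF x] by (simp add: F_def)
  also have "\<dots> = (\<Otimes>c\<in>F. f (b c [^] \<kappa> c x))"
    using F b_carrier by (intro End_finprod[OF f]) auto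
  finally have "[\<kappa> d (f x) = (\<Sum>c\<in>F. \<kappa> d (f (b c [^] \<kappa> c x)))] (mod Q d)"
    using \<kappa>_finprod[OF F(1) _ d, of "\<lambda>c. f (b c [^] \<kappa> c x)"] F b_carrier End_ring_carrierD(1)[OF f]
    by (simp add: Pi_iff subset_iff)
  also have "[(\<Sum>c\<in>F. \<kappa> d (f (b c [^] \<kappa> c x))) = (\<Sum>c\<in>F. \<kappa> c x * \<kappa> d (f (b c)))] (mod Q d)"
  proof (rule cong_sum)
    fix c assume "c \<in> F"
    then have "c \<in> C" using F by blast
    then show "[\<kappa> d (f (b c [^] \<kappa> c x)) = \<kappa> c x * \<kappa> d (f (b c))] (mod Q d)"
      using \<kappa>_int_pow[OF d] End_int_pow[OF f] End_ring_carrierD(1)[OF f] b_carrier by simp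
  qed
  finally show ?thesis by (simp add: F_def)
qed

text \<open>\<open>q\<close> and \<open>k\<close> are kept free for two uses: \<open>k = p\<close>
  with \<open>q = 1\<close> for the radical, and \<open>k = Q d\<close> with \<open>q\<close> a
  power of p for the annihilating sequence.\<close>

lemma dvd_entry:
  assumes "f \<in> carrier E" "x \<in> carrier G" "d \<in> C" "k dvd Q d"
    and "\<And>c. c \<in> C \<Longrightarrow> k dvd q * (\<kappa> c x * \<kappa> d (f (b c)))"
  shows "k dvd q * \<kappa> d (f x)"
  using cong_dvd_mult_iff[OF entry_expansion[OF assms(1-3)] assms(4), of q] assms(5)
  by (auto simp: sum_distrib_left intro!: dvd_sum)

lemma End_eqI:
  assumes "f \<in> carrier E" "g \<in> carrier E"
    and "\<And>c d. c \<in> C \<Longrightarrow> d \<in> C \<Longrightarrow> [\<kappa> d (f (b c)) = \<kappa> d (g (b c))] (mod Q d)"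
  shows "f = g"
proof (rule End_ring_ext[OF assms(1,2)])
  fix x assume x: "x \<in> carrier G"
  show "f x = g x"
  proof (rule eq_if_\<kappa>_cong)
    fix d assume d: "d \<in> C"
    have "[(\<Sum>c\<in>{c \<in> C. \<not> Q c dvd \<kappa> c x}. \<kappa> c x * \<kappa> d (f (b c)))
         = (\<Sum>c\<in>{c \<in> C. \<not> Q c dvd \<kappa> c x}. \<kappa> c x * \<kappa> d (g (b c)))] (mod Q d)"
      using assms(3) d by (intro cong_sum cong_scalar_left) auto
    then show "[\<kappa> d (f x) = \<kappa> d (g x)] (mod Q d)"
      using entry_expansion[OF assms(1) x d] entry_expansion[OF assms(2) x d]
      by (meson cong_sym cong_trans)
  qed (use End_ring_carrierD(1)[OF assms(1) x] End_ring_carrierD(1)[OF assms(2) x] in simp_all)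
qed

lemma Q_dvd_entry:
  assumes "f \<in> carrier E" "c \<in> C" "d \<in> C"
  shows "Q d dvd Q c * \<kappa> d (f (b c))"
proof -
  have "f (b c) [^] Q c = f (b c [^] Q c)"
    using assms b_carrier by (simp add: End_int_pow)
  also have "\<dots> = \<one>"
    using assms b_pow_one[of c "Q c"] hom_one[OF End_ring_carrierD(3) is_group is_group] by simp
  finally have "[\<kappa> d (f (b c) [^] Q c) = 0] (mod Q d)" using \<kappa>_one assms by simp
  then show ?thesis
    using \<kappa>_int_pow[OF assms(3), of "f (b c)" "Q c"] assms b_carrier End_ring_carrierD(1)
    by (metis cong_0_iff cong_dvd_iff)
qed

text \<open>\<open>Q c\<close> kills the image of \<open>b c\<close>; this is the origin of the
  weight \<open>n j - n i\<close> in \<open>step_weight\<close>.\<close>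

lemma power_diff_dvd_entry:
  assumes "f \<in> carrier E" "c \<in> C" "d \<in> C"
  shows "int p ^ (n (lev d) - n (lev c)) dvd \<kappa> d (f (b c))"
proof (cases "n (lev c) \<le> n (lev d)")
  case True
  then have "Q d = Q c * int p ^ (n (lev d) - n (lev c))" by (simp flip: power_add)
  then show ?thesis using Q_dvd_entry[OF assms] p_gt_1 by simp
qed simp

subsection \<open>Elementary endomorphisms and scalars\<close>

text \<open>Sends \<open>b c\<close> to \<open>y\<close> and the other basis elements to the
  identity. It is a homomorphism once \<open>Q c\<close> kills \<open>y\<close>, although
  \<open>\<kappa> c\<close> is additive only modulo \<open>Q c\<close>. For \<open>y\<close> a power
  of \<open>b d\<close> it is a multiple of a matrix unit.\<close>

definition elem :: "'c \<Rightarrow> 'a \<Rightarrow> 'a \<Rightarrow> 'a" where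
  "elem c y = (\<lambda>x\<in>carrier G. y [^] \<kappa> c x)"

lemma elem_in_E:
  assumes "c \<in> C" "y \<in> carrier G" "y [^] Q c = \<one>"
  shows "elem c y \<in> carrier E"
proof -
  have "y [^] \<kappa> c (u \<otimes> v) = y [^] \<kappa> c u \<otimes> y [^] \<kappa> c v" if "u \<in> carrier G" "v \<in> carrier G" for u v
    using pow_cong[OF assms(2,3) \<kappa>_mult[OF assms(1) that]] assms(2) by (simp add: int_pow_mult)
  then show ?thesis using assms by (auto simp: End_ring_def elem_def hom_def)
qed

lemma elem_apply: "x \<in> carrier G \<Longrightarrow> elem c y x = y [^] \<kappa> c x"
  by (simp add: elem_def)

lemma elem_b:
  assumes "c \<in> C" "y \<in> carrier G" "y [^] Q c = \<one>" "d \<in> C"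
  shows "elem c y (b d) = (if d = c then y else \<one>)"
  using pow_cong[OF assms(2,3) \<kappa>_b[OF assms(1,4)]] assms b_carrier by (auto simp: elem_apply)

lemma b_pow_wt:
  assumes "c \<in> C" "d \<in> C"
  shows "(b d [^] int p ^ wt c d) [^] Q c = \<one>"
proof -
  have "Q d dvd int p ^ (wt c d + n (lev c))"
    using wt_swap[OF assms] by (intro le_imp_power_dvd) linarith
  then show ?thesis
    using b_pow_one[OF assms(2)] b_carrier assms by (simp add: int_pow_pow power_add)
qed

definition scalar :: "int \<Rightarrow> 'a \<Rightarrow> 'a" where
  "scalar k = (\<lambda>x\<in>carrier G. x [^] k)"

lemma scalar_apply: "x \<in> carrier G \<Longrightarrow> scalar k x = x [^] k"
  by (simp add: scalar_def)

lemma scalar_in_E: "scalar k \<in> carrier E"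
  by (auto simp: End_ring_def scalar_def hom_def int_pow_distrib)

lemma scalar_central: "scalar k \<in> ring_center E"
proof -
  have "scalar k \<otimes>\<^bsub>E\<^esub> f = f \<otimes>\<^bsub>E\<^esub> scalar k" if "f \<in> carrier E" for f
    using that scalar_in_E End_ring_carrierD(1)[OF that]
    by (intro End_ring_ext) (auto simp: End_ring_apply scalar_apply End_int_pow)
  then show ?thesis using scalar_in_E by (simp add: ring_center_def)
qed

lemma exponent_top:
  assumes "lev tp = s" "tp \<in> C" "x \<in> carrier G"
  shows "x [^] Q tp = \<one>"
proof (rule pow_exponent_one)
  fix c assume c: "c \<in> C"
  have "lev c \<le> lev tp" using lev_in[OF c] assms(1) by simp
  then show "Q c dvd Q tp * \<kappa> c x"
    using n_le_iff[OF c assms(2)] by (simp add: le_imp_power_dvd dvd_mult2)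
qed (use assms in auto)

text \<open>Since \<open>Q tp\<close> kills \<open>G\<close>, some endomorphism sends
  \<open>b tp\<close> to any prescribed \<open>y\<close>; commuting with it forces \<open>z\<close>
  to act on \<open>y\<close> with the exponent read off at \<open>b tp\<close>.\<close>

lemma central_is_scalar:
  assumes tp: "lev tp = s" "tp \<in> C" and z: "z \<in> ring_center E"
  shows "\<exists>k. z = scalar k"
proof -
  have zE: "z \<in> carrier E" "\<And>f. f \<in> carrier E \<Longrightarrow> z \<otimes>\<^bsub>E\<^esub> f = f \<otimes>\<^bsub>E\<^esub> z"
    using z by (auto simp: ring_center_def)
  have "z = scalar (\<kappa> tp (z (b tp)))"
  proof (rule End_ring_ext[OF zE(1) scalar_in_E])
    fix y assume y: "y \<in> carrier G"
    note e = elem_in_E[OF tp(2) y exponent_top[OF tp y]]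
    have "(z \<otimes>\<^bsub>E\<^esub> elem tp y) (b tp) = (elem tp y \<otimes>\<^bsub>E\<^esub> z) (b tp)"
      using zE(2)[OF e] by simp
    then have "z (elem tp y (b tp)) = elem tp y (z (b tp))"
      using b_carrier tp by (simp add: End_ring_apply)
    then show "z y = scalar (\<kappa> tp (z (b tp))) y"
      using elem_b[OF tp(2) y exponent_top[OF tp y] tp(2)] y b_carrier[OF tp(2)]
        End_ring_carrierD(1)[OF zE(1)]
      by (simp add: elem_apply scalar_apply)
  qed
  then show ?thesis ..
qed

text \<open>Supplies the \<open>faithful\<close> condition for the projection
  \<open>elem tp (b tp)\<close>: suitable \<open>h\<close> send \<open>b tp\<close> to every
  \<open>x\<close> in \<open>G\<close>.\<close>

lemma top_faithful:
  assumes tp: "lev tp = s" "tp \<in> C" and y: "y \<in> carrier E"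
    and "\<And>h. h \<in> carrier E \<Longrightarrow> y \<otimes>\<^bsub>E\<^esub> h \<otimes>\<^bsub>E\<^esub> elem tp (b tp) = \<zero>\<^bsub>E\<^esub>"
  shows "y = \<zero>\<^bsub>E\<^esub>"
proof (rule End_ring_ext[OF y])
  fix x assume x: "x \<in> carrier G"
  have bt: "b tp \<in> carrier G" using b_carrier tp by simp
  note ex = exponent_top[OF tp]
  have "(y \<otimes>\<^bsub>E\<^esub> elem tp x \<otimes>\<^bsub>E\<^esub> elem tp (b tp)) (b tp) = \<one>"
    using assms(4)[OF elem_in_E[OF tp(2) x ex[OF x]]] bt by (simp add: End_ring_apply)
  then show "y x = \<zero>\<^bsub>E\<^esub> x"
    using bt x elem_b[OF tp(2) bt ex[OF bt] tp(2)] elem_b[OF tp(2) x ex[OF x] tp(2)]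
    by (simp add: End_ring_apply)
qed simp

subsection \<open>The radical in coordinates\<close>

definition rad :: "('a \<Rightarrow> 'a) set" where
  "rad = {f \<in> carrier E. \<forall>c\<in>C. \<forall>d\<in>C. lev c = lev d \<longrightarrow> int p dvd \<kappa> d (f (b c))}"

lemma rad_subset: "rad \<subseteq> carrier E"
  by (auto simp: rad_def)

lemma radI:
  assumes "f \<in> carrier E"
    and "\<And>c d. c \<in> C \<Longrightarrow> d \<in> C \<Longrightarrow> lev c = lev d \<Longrightarrow> int p dvd \<kappa> d (f (b c))"
  shows "f \<in> rad"
  using assms by (simp add: rad_def)

lemma wt_dvd_entry:
  assumes "f \<in> rad" "c \<in> C" "d \<in> C"
  shows "int p ^ wt c d dvd \<kappa> d (f (b c))"
  using power_diff_dvd_entry[of f c d] assms by (auto simp: rad_def step_weight_def)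

text \<open>Common reason why \<open>rad\<close> and \<open>level_annihilator\<close> absorb left
  multiplication; \<open>y\<close> is the image of a basis element on the level of \<open>d\<close>.
  Through a lower level \<open>g\<close> contributes the factor p; through the same or a higher
  level the coordinate of \<open>y\<close> does.\<close>

lemma End_entry_comp_dvd:
  assumes g: "g \<in> carrier E" and y: "y \<in> carrier G" and d: "d \<in> C"
    and y_killed: "\<And>k. k \<in> C \<Longrightarrow> Q k dvd Q d * \<kappa> k y"
    and y_dvd: "\<And>k. k \<in> C \<Longrightarrow> lev k = lev d \<Longrightarrow> int p dvd \<kappa> k y"
  shows "int p dvd \<kappa> d (g y)"
proof -
  have "int p dvd 1 * \<kappa> d (g y)"
  proof (rule dvd_entry[OF g y d p_dvd_Q[OF d]])
    fix k assume k: "k \<in> C"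
    show "int p dvd 1 * (\<kappa> k y * \<kappa> d (g (b k)))"
    proof (cases "n (lev k)" "n (lev d)" rule: linorder_cases)
      case less
      then have "int p dvd int p ^ (n (lev d) - n (lev k))" by simp
      then show ?thesis using power_diff_dvd_entry[OF g k d] by (meson dvd_mult dvd_trans)
    next
      case equal
      then show ?thesis using y_dvd[OF k] n_eq_iff[OF k d] by simp
    next
      case greater
      have "Q k = Q d * int p ^ (n (lev k) - n (lev d))"
        using greater by (simp flip: power_add)
      then have "int p ^ (n (lev k) - n (lev d)) dvd \<kappa> k y"
        using y_killed[OF k] p_gt_1 by simp
      moreover have "int p dvd int p ^ (n (lev k) - n (lev d))" using greater by simp
      ultimately have "int p dvd \<kappa> k y" using dvd_trans by blast
      then show ?thesis by simp
    qed
  qed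
  then show ?thesis by simp
qed

lemma rad_ideal: "ideal rad E"
proof (rule E.ideal_if_closed)
  fix x y assume xy: "x \<in> rad" "y \<in> rad"
  show "x \<oplus>\<^bsub>E\<^esub> y \<in> rad"
  proof (rule radI)
    fix c d assume cd: "c \<in> C" "d \<in> C" "lev c = lev d"
    have "[\<kappa> d ((x \<oplus>\<^bsub>E\<^esub> y) (b c)) = \<kappa> d (x (b c)) + \<kappa> d (y (b c))] (mod Q d)"
      unfolding End_ring_apply[OF b_carrier[OF cd(1)]]
      using xy rad_subset End_ring_carrierD(1)[OF _ b_carrier[OF cd(1)]] by (intro \<kappa>_mult cd) auto
    then have "[\<kappa> d ((x \<oplus>\<^bsub>E\<^esub> y) (b c)) = \<kappa> d (x (b c)) + \<kappa> d (y (b c))] (mod int p)"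
      using p_dvd_Q[OF cd(2)] by (rule cong_dvd_modulus)
    moreover have "int p dvd \<kappa> d (x (b c)) + \<kappa> d (y (b c))"
      using xy cd by (auto simp: rad_def)
    ultimately show "int p dvd \<kappa> d ((x \<oplus>\<^bsub>E\<^esub> y) (b c))" by (simp add: cong_dvd_iff)
  qed (use xy rad_subset in auto)
next
  fix r x assume r: "r \<in> carrier E" and x: "x \<in> rad"
  have xE: "x \<in> carrier E" using x rad_subset by auto
  show "r \<otimes>\<^bsub>E\<^esub> x \<in> rad"
  proof (rule radI)
    fix c d assume cd: "c \<in> C" "d \<in> C" "lev c = lev d"
    have "int p dvd \<kappa> d (r (x (b c)))"
    proof (rule End_entry_comp_dvd[OF r])
      fix k assume "k \<in> C"
      then show "Q k dvd Q d * \<kappa> k (x (b c))" using Q_dvd_entry[OF xE, of c k] cd by simp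
    qed (use x cd b_carrier End_ring_carrierD(1)[OF xE] in \<open>auto simp: rad_def\<close>)
    then show "int p dvd \<kappa> d ((r \<otimes>\<^bsub>E\<^esub> x) (b c))"
      using cd b_carrier by (simp add: End_ring_apply)
  qed (use r xE in auto)
  show "x \<otimes>\<^bsub>E\<^esub> r \<in> rad"
  proof (rule radI)
    fix c d assume cd: "c \<in> C" "d \<in> C" "lev c = lev d"
    have rb: "r (b c) \<in> carrier G" using cd b_carrier End_ring_carrierD(1)[OF r] by auto
    have "int p dvd 1 * \<kappa> d (x (r (b c)))"
    proof (rule dvd_entry[OF xE rb cd(2) p_dvd_Q[OF cd(2)]])
      fix k assume k: "k \<in> C"
      show "int p dvd 1 * (\<kappa> k (r (b c)) * \<kappa> d (x (b k)))"
      \<comment> \<open>From \<open>c\<close> through \<open>k\<close> back to the level of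
        \<open>c\<close>: if \<open>r\<close> climbs, its entry is divisible by p; otherwise
        \<open>x\<close> has to stay or climb, and its weight is positive.\<close>
      proof (cases "n (lev c) < n (lev k)")
        case True
        then have "int p dvd int p ^ (n (lev k) - n (lev c))" by simp
        then show ?thesis
          using power_diff_dvd_entry[OF r cd(1) k] by (metis dvd_trans dvd_mult2 mult_1)
      next
        case False
        then have "0 < wt k d"
          using cd(3) by (auto simp: step_weight_def) (metis cd(2,3) k le_neq_implies_less n_eq_iff not_less)
        then have "int p dvd int p ^ wt k d" by simp
        then show ?thesis using wt_dvd_entry[OF x k cd(2)] by (metis dvd_trans dvd_mult mult_1)
      qed
    qed
    then show "int p dvd \<kappa> d ((x \<otimes>\<^bsub>E\<^esub> r) (b c))"
      using cd b_carrier by (simp add: End_ring_apply)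
  qed (use r xE in auto)
next
  show "\<zero>\<^bsub>E\<^esub> \<in> rad"
  proof (rule radI)
    fix c d assume cd: "c \<in> C" "d \<in> C"
    show "int p dvd \<kappa> d (\<zero>\<^bsub>E\<^esub> (b c))"
      using \<kappa>_one[OF cd(2)] p_dvd_Q[OF cd(2)] b_carrier[OF cd(1)]
      by (auto simp: End_ring_apply cong_0_iff intro: dvd_trans)
  qed simp
qed (rule rad_subset)

text \<open>Their only nonzero entry is the lowest power of p that \<open>wt_dvd_entry\<close>
  admits; these are the test elements for the necessity arguments below.\<close>

lemma elem_wt_in_rad:
  assumes c: "c \<in> C" and d: "d \<in> C"
  shows "elem c (b d [^] int p ^ wt c d) \<in> rad"
proof (rule radI)
  let ?y = "b d [^] int p ^ wt c d"
  have y: "?y \<in> carrier G" using b_carrier d by simp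
  show "elem c ?y \<in> carrier E" by (rule elem_in_E[OF c y b_pow_wt[OF c d]])
  fix k l assume kl: "k \<in> C" "l \<in> C" "lev k = lev l"
  show "int p dvd \<kappa> l (elem c ?y (b k))"
  proof (cases "k = c")
    case True
    have "[\<kappa> l ?y = int p ^ wt c d * \<kappa> l (b d)] (mod Q l)"
      using \<kappa>_int_pow kl b_carrier d by simp
    moreover have "int p dvd int p ^ wt c d * \<kappa> l (b d)"
    proof (cases "l = d")
      case True
      then show ?thesis using kl \<open>k = c\<close> by (simp add: step_weight_def)
    next
      case False
      then have "int p dvd \<kappa> l (b d)"
        using \<kappa>_b[OF kl(2) d] p_dvd_Q[OF kl(2)] by (auto simp: cong_0_iff intro: dvd_trans)
      then show ?thesis by simp
    qed
    ultimately have "int p dvd \<kappa> l ?y"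
      using cong_dvd_iff cong_dvd_modulus p_dvd_Q[OF kl(2)] by metis
    then show ?thesis using elem_b[OF c y b_pow_wt[OF c d] kl(1)] True by simp
  next
    case False
    then show ?thesis
      using elem_b[OF c y b_pow_wt[OF c d] kl(1)] \<kappa>_one[OF kl(2)] p_dvd_Q[OF kl(2)]
      by (auto simp: cong_0_iff intro: dvd_trans)
  qed
qed

lemma scalar_in_rad:
  assumes "int p dvd k"
  shows "scalar k \<in> rad"
proof (rule radI[OF scalar_in_E])
  fix c d assume "c \<in> C" "d \<in> C"
  then show "int p dvd \<kappa> d (scalar k (b c))"
    using \<kappa>_int_pow[of d "b c" k] b_carrier p_dvd_Q[of d] assms
    by (simp add: scalar_apply) (metis cong_dvd_iff cong_dvd_modulus dvd_mult2)
qed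

text \<open>A product with an element of \<open>rad\<close> runs through some level and picks up the
  weight of that step, so \<open>upper_fun_step\<close> gives the divisibilities of the product.
  Conversely, the term attaining the minimum names a multiple of a matrix unit whose product with
  \<open>a\<close> isolates the wanted entry.\<close>

theorem upper_annihilating_rad_iff:
  assumes "a \<in> rad"
  shows "a \<in> upper_annihilating E rad t \<longleftrightarrow>
    (\<forall>c\<in>C. \<forall>d\<in>C. Q d dvd int p ^ \<alpha> c d t * \<kappa> d (a (b c)))"
  using assms
proof (induction t arbitrary: a)
  case 0
  have aE: "a \<in> carrier E" using 0 rad_subset by blast
  have "a = \<zero>\<^bsub>E\<^esub> \<longleftrightarrow> (\<forall>c\<in>C. \<forall>d\<in>C. Q d dvd \<kappa> d (a (b c)))"
  proof
    assume "a = \<zero>\<^bsub>E\<^esub>"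
    then show "\<forall>c\<in>C. \<forall>d\<in>C. Q d dvd \<kappa> d (a (b c))"
      using \<kappa>_one b_carrier by (simp add: End_ring_apply cong_0_iff)
  next
    assume *: "\<forall>c\<in>C. \<forall>d\<in>C. Q d dvd \<kappa> d (a (b c))"
    show "a = \<zero>\<^bsub>E\<^esub>"
    proof (rule End_eqI[OF aE E.zero_closed])
      fix c d assume cd: "c \<in> C" "d \<in> C"
      then have "[\<kappa> d (a (b c)) = 0] (mod Q d)" using * by (simp add: cong_0_iff)
      then show "[\<kappa> d (a (b c)) = \<kappa> d (\<zero>\<^bsub>E\<^esub> (b c))] (mod Q d)"
        using \<kappa>_one[OF cd(2)] b_carrier[OF cd(1)] by (simp add: End_ring_apply) (meson cong_sym cong_trans)
    qed
  qed
  then show ?case by simp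
next
  case (Suc t)
  interpret rad: ideal rad E by (rule rad_ideal)
  have aE: "a \<in> carrier E" using Suc.prems rad_subset by blast
  note step = upper_fun_step[OF n_mono lev_in lev_in lev_in]
  show ?case
  proof
    assume *: "\<forall>c\<in>C. \<forall>d\<in>C. Q d dvd int p ^ \<alpha> c d (Suc t) * \<kappa> d (a (b c))"
    have "a \<otimes>\<^bsub>E\<^esub> x \<in> upper_annihilating E rad t \<and> x \<otimes>\<^bsub>E\<^esub> a \<in> upper_annihilating E rad t"
      if x: "x \<in> rad" for x
    proof
      have xE: "x \<in> carrier E" using x rad_subset by blast
      have "Q d dvd int p ^ \<alpha> c d t * \<kappa> d ((a \<otimes>\<^bsub>E\<^esub> x) (b c))" if c: "c \<in> C" and d: "d \<in> C" for c d
      proof -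
        have xb: "x (b c) \<in> carrier G" using End_ring_carrierD(1)[OF xE] b_carrier c by simp
        have "Q d dvd int p ^ \<alpha> c d t * \<kappa> d (a (x (b c)))"
        proof (rule dvd_entry[OF aE xb d dvd_refl])
          fix k assume k: "k \<in> C"
          obtain m where m: "\<kappa> k (x (b c)) = int p ^ wt c k * m"
            using wt_dvd_entry[OF x c k] by blast
          have "Q d dvd int p ^ \<alpha> k d (Suc t) * \<kappa> d (a (b k))" using * k d by blast
          also have "\<dots> dvd int p ^ (\<alpha> c d t + wt c k) * \<kappa> d (a (b k))"
            by (intro mult_dvd_mono le_imp_power_dvd step(1) k d c dvd_refl)
          also have "\<dots> dvd int p ^ \<alpha> c d t * (\<kappa> k (x (b c)) * \<kappa> d (a (b k)))"
            unfolding m by (simp add: power_add ac_simps)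
          finally show "Q d dvd int p ^ \<alpha> c d t * (\<kappa> k (x (b c)) * \<kappa> d (a (b k)))" .
        qed
        then show ?thesis using b_carrier c by (simp add: End_ring_apply)
      qed
      then show "a \<otimes>\<^bsub>E\<^esub> x \<in> upper_annihilating E rad t"
        using Suc.IH[of "a \<otimes>\<^bsub>E\<^esub> x"] x aE by (simp add: rad.I_l_closed)
      have "Q d dvd int p ^ \<alpha> c d t * \<kappa> d ((x \<otimes>\<^bsub>E\<^esub> a) (b c))" if c: "c \<in> C" and d: "d \<in> C" for c d
      proof -
        have ab: "a (b c) \<in> carrier G" using End_ring_carrierD(1)[OF aE] b_carrier c by simp
        have "Q d dvd int p ^ \<alpha> c d t * \<kappa> d (x (a (b c)))"
        proof (rule dvd_entry[OF xE ab d dvd_refl])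
          fix k assume k: "k \<in> C"
          obtain m where m: "\<kappa> d (x (b k)) = int p ^ wt k d * m"
            using wt_dvd_entry[OF x k d] by blast
          have "Q k dvd int p ^ \<alpha> c k (Suc t) * \<kappa> k (a (b c))" using * k c by blast
          also have "\<dots> dvd int p ^ (\<alpha> c d t + wt d k) * \<kappa> k (a (b c))"
            by (intro mult_dvd_mono le_imp_power_dvd step(2) k d c dvd_refl)
          \<comment> \<open>The hypothesis is modulo \<open>Q k\<close>, the goal modulo
            \<open>Q d\<close>: after multiplication by \<open>p ^ wt k d\<close>,
            \<open>wt_swap\<close> turns the left side into \<open>p ^ wt d k * Q d\<close>, and
            \<open>p ^ wt d k\<close> cancels.\<close>
          finally have "int p ^ wt k d * Q k dvd
            int p ^ wt k d * (int p ^ (\<alpha> c d t + wt d k) * \<kappa> k (a (b c)))" by simp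
          also have "\<dots> dvd int p ^ wt d k * (int p ^ \<alpha> c d t * (\<kappa> k (a (b c)) * \<kappa> d (x (b k))))"
            unfolding m by (simp add: power_add ac_simps)
          finally have "int p ^ wt d k * Q d dvd
            int p ^ wt d k * (int p ^ \<alpha> c d t * (\<kappa> k (a (b c)) * \<kappa> d (x (b k))))"
            using wt_swap[OF k d] by (simp flip: power_add)
          then show "Q d dvd int p ^ \<alpha> c d t * (\<kappa> k (a (b c)) * \<kappa> d (x (b k)))"
            using p_gt_1 by simp
        qed
        then show ?thesis using b_carrier c by (simp add: End_ring_apply)
      qed
      then show "x \<otimes>\<^bsub>E\<^esub> a \<in> upper_annihilating E rad t"
        using Suc.IH[of "x \<otimes>\<^bsub>E\<^esub> a"] x aE by (simp add: rad.I_r_closed)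
    qed
    then show "a \<in> upper_annihilating E rad (Suc t)"
      using Suc.prems unfolding E.upper_annihilating_Suc_iff by blast
  next
    assume *: "a \<in> upper_annihilating E rad (Suc t)"
    show "\<forall>c\<in>C. \<forall>d\<in>C. Q d dvd int p ^ \<alpha> c d (Suc t) * \<kappa> d (a (b c))"
    proof (intro ballI)
      fix c d assume c: "c \<in> C" and d: "d \<in> C"
      have bc: "b c \<in> carrier G" "a (b c) \<in> carrier G"
        using End_ring_carrierD(1)[OF aE] b_carrier c by auto
      from upper_fun_Suc_attained[OF n_mono lev_in[OF c] lev_in[OF d], of t]
      obtain i where "i \<in> {1..s}" and i: "\<alpha> c d (Suc t) = upper_fun n s i (lev d) t + step_weight n i (lev c)
          \<or> \<alpha> c d (Suc t) = upper_fun n s (lev c) i t + step_weight n i (lev d)" by blast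
      then obtain k where k: "k \<in> C" "lev k = i" using ex_lev by blast
      with i consider "\<alpha> c d (Suc t) = \<alpha> k d t + wt k c" | "\<alpha> c d (Suc t) = \<alpha> c k t + wt k d"
        by blast
      then show "Q d dvd int p ^ \<alpha> c d (Suc t) * \<kappa> d (a (b c))"
      proof cases
        case 1
        \<comment> \<open>With \<open>b k\<close> sent to this power of \<open>b c\<close>, the
          entry of the product from \<open>k\<close> to \<open>d\<close> is
          \<open>p ^ wt k c\<close> times that of \<open>a\<close> from \<open>c\<close> to
          \<open>d\<close>.\<close>
        define y where "y = b c [^] int p ^ wt k c"
        have y: "y \<in> carrier G" "y [^] Q k = \<one>"
          using b_pow_wt[OF k(1) c] bc by (auto simp: y_def)
        have x: "elem k y \<in> rad" using elem_wt_in_rad[OF k(1) c] by (simp add: y_def)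
        have "a \<otimes>\<^bsub>E\<^esub> elem k y \<in> upper_annihilating E rad t"
          using * x unfolding E.upper_annihilating_Suc_iff by blast
        then have "Q d dvd int p ^ \<alpha> k d t * \<kappa> d ((a \<otimes>\<^bsub>E\<^esub> elem k y) (b k))"
          using Suc.IH[of "a \<otimes>\<^bsub>E\<^esub> elem k y"] x aE k(1) d by (simp add: rad.I_l_closed)
        moreover have "(a \<otimes>\<^bsub>E\<^esub> elem k y) (b k) = a (b c) [^] int p ^ wt k c"
          using b_carrier[OF k(1)] elem_b[OF k(1) y k(1)] aE bc
          by (simp add: End_ring_apply End_int_pow y_def)
        ultimately have "Q d dvd int p ^ \<alpha> k d t * (int p ^ wt k c * \<kappa> d (a (b c)))"
          using cong_dvd_mult_iff[OF \<kappa>_int_pow[OF d bc(2)] dvd_refl] by simp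
        then show ?thesis by (simp add: 1 power_add ac_simps)
      next
        case 2
        \<comment> \<open>The mirror image: the entry of the product from \<open>c\<close> to
          \<open>k\<close> is \<open>p ^ wt d k\<close> times that of \<open>a\<close> from
          \<open>c\<close> to \<open>d\<close>; the moduli are again exchanged by
          \<open>wt_swap\<close>.\<close>
        define y where "y = b k [^] int p ^ wt d k"
        have y: "y \<in> carrier G" "y [^] Q d = \<one>"
          using b_pow_wt[OF d k(1)] b_carrier k(1) by (auto simp: y_def)
        have x: "elem d y \<in> rad" using elem_wt_in_rad[OF d k(1)] by (simp add: y_def)
        have "elem d y \<otimes>\<^bsub>E\<^esub> a \<in> upper_annihilating E rad t"
          using * x unfolding E.upper_annihilating_Suc_iff by blast
        then have "Q k dvd int p ^ \<alpha> c k t * \<kappa> k ((elem d y \<otimes>\<^bsub>E\<^esub> a) (b c))"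
          using Suc.IH[of "elem d y \<otimes>\<^bsub>E\<^esub> a"] x aE k(1) c by (simp add: rad.I_r_closed)
        moreover have "(elem d y \<otimes>\<^bsub>E\<^esub> a) (b c) = b k [^] (int p ^ wt d k * \<kappa> d (a (b c)))"
          using bc b_carrier[OF k(1)] by (simp add: End_ring_apply elem_apply y_def int_pow_pow)
        moreover have "[\<kappa> k (b k [^] (int p ^ wt d k * \<kappa> d (a (b c))))
            = int p ^ wt d k * \<kappa> d (a (b c)) * 1] (mod Q k)"
          by (rule cong_trans[OF \<kappa>_int_pow[OF k(1) b_carrier[OF k(1)]] cong_scalar_left])
            (use \<kappa>_b[OF k(1) k(1)] in simp)
        ultimately have "Q k dvd int p ^ \<alpha> c k t * (int p ^ wt d k * \<kappa> d (a (b c)))"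
          using cong_dvd_mult_iff[OF _ dvd_refl] by simp
        then have "int p ^ wt k d * Q k dvd
            int p ^ wt k d * (int p ^ \<alpha> c k t * (int p ^ wt d k * \<kappa> d (a (b c))))" by simp
        also have "\<dots> = int p ^ wt d k * (int p ^ \<alpha> c d (Suc t) * \<kappa> d (a (b c)))"
          unfolding 2 by (simp add: power_add)
        also have "int p ^ wt k d * Q k = int p ^ wt d k * Q d"
          using wt_swap[OF k(1) d] by (simp flip: power_add)
        finally have "int p ^ wt d k * Q d dvd int p ^ wt d k * (int p ^ \<alpha> c d (Suc t) * \<kappa> d (a (b c)))" .
        then show ?thesis using p_gt_1 by simp
      qed
    qed
  qed
qed

lemma upper_annihilating_rad_top: "\<exists>N. upper_annihilating E rad N = rad"
proof
  \<comment> \<open>By \<open>upper_fun_lower_bound\<close> every exponent is at least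
    \<open>n s\<close> at this index.\<close>
  let ?N = "2 * n s + 2 * s"
  have "a \<in> upper_annihilating E rad ?N" if a: "a \<in> rad" for a
    unfolding upper_annihilating_rad_iff[OF a]
  proof (intro ballI dvd_mult2 le_imp_power_dvd)
    fix c d assume c: "c \<in> C" and d: "d \<in> C"
    have "n (lev d) \<le> n s"
      using lev_in[OF d] by (intro strict_mono_on_leD[OF n_mono]) auto
    then show "n (lev d) \<le> \<alpha> c d ?N"
      using upper_fun_lower_bound[OF n_mono lev_in[OF c] lev_in[OF d], of ?N] by linarith
  qed
  then show "upper_annihilating E rad ?N = rad"
    using E.upper_annihilating_subset[OF rad_ideal] by blast
qed

subsection \<open>The Jacobson radical\<close>

text \<open>One left ideal for each column; their intersection is \<open>rad\<close>, so their
  maximality bounds the Jacobson radical from above.\<close>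

definition level_annihilator :: "'c \<Rightarrow> ('a \<Rightarrow> 'a) set" where
  "level_annihilator c = {f \<in> carrier E. \<forall>d\<in>C. lev d = lev c \<longrightarrow> int p dvd \<kappa> d (f (b c))}"

text \<open>An \<open>h\<close> outside has an entry prime to p on the level of \<open>c\<close>;
  inverting it gives an endomorphism that carries \<open>h (b c)\<close> back to \<open>b c\<close>.
  Then 1 minus its product with \<open>h\<close> kills \<open>b c\<close>, so it lies in the ideal,
  and a larger left ideal containing \<open>h\<close> contains 1.\<close>

lemma maximal_level_annihilator:
  assumes c: "c \<in> C"
  shows "maximal_left_ideal (level_annihilator c) E"
proof -
  let ?M = "level_annihilator c"
  have bc: "b c \<in> carrier G" using b_carrier c by simp
  have "left_ideal ?M E"
  proof (rule E.left_ideal_if_closed)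
    fix x y assume xy: "x \<in> ?M" "y \<in> ?M"
    have "int p dvd \<kappa> d ((x \<oplus>\<^bsub>E\<^esub> y) (b c))" if d: "d \<in> C" "lev d = lev c" for d
    proof -
      have "[\<kappa> d (x (b c) \<otimes> y (b c)) = \<kappa> d (x (b c)) + \<kappa> d (y (b c))] (mod int p)"
        using xy End_ring_carrierD(1)[OF _ bc] unfolding level_annihilator_def
        by (intro cong_dvd_modulus[OF \<kappa>_mult[OF d(1)] p_dvd_Q[OF d(1)]]) auto
      then show ?thesis
        using xy d bc by (simp add: level_annihilator_def End_ring_apply cong_dvd_iff)
    qed
    then show "x \<oplus>\<^bsub>E\<^esub> y \<in> ?M" using xy by (simp add: level_annihilator_def)
  next
    fix r x assume r: "r \<in> carrier E" and x: "x \<in> ?M"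
    have xE: "x \<in> carrier E" using x by (simp add: level_annihilator_def)
    have "int p dvd \<kappa> d (r (x (b c)))" if d: "d \<in> C" "lev d = lev c" for d
    proof (rule End_entry_comp_dvd[OF r])
      fix k assume "k \<in> C"
      then show "Q k dvd Q d * \<kappa> k (x (b c))" using Q_dvd_entry[OF xE c] d by simp
    qed (use x d bc End_ring_carrierD(1)[OF xE] in \<open>auto simp: level_annihilator_def\<close>)
    then show "r \<otimes>\<^bsub>E\<^esub> x \<in> ?M"
      using r xE bc by (simp add: level_annihilator_def End_ring_apply)
  next
    have "int p dvd \<kappa> d \<one>" if "d \<in> C" for d
      using \<kappa>_one[OF that] p_dvd_Q[OF that] by (auto simp: cong_0_iff intro: dvd_trans)
    then show "\<zero>\<^bsub>E\<^esub> \<in> ?M" using bc by (simp add: level_annihilator_def End_ring_apply)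
  qed (auto simp: level_annihilator_def)
  moreover have "\<one>\<^bsub>E\<^esub> \<notin> ?M"
  proof
    assume "\<one>\<^bsub>E\<^esub> \<in> ?M"
    then have "int p dvd \<kappa> c (b c)" using c bc by (simp add: level_annihilator_def End_ring_apply)
    moreover have "[\<kappa> c (b c) = 1] (mod int p)"
      using \<kappa>_b[OF c c] p_dvd_Q[OF c] by (auto intro: cong_dvd_modulus)
    ultimately have "int p dvd 1" by (simp add: cong_dvd_iff)
    then show False using p_gt_1 by simp
  qed
  moreover have "I = carrier E" if I: "left_ideal I E" "?M \<subseteq> I" "I \<noteq> ?M" for I
  proof -
    interpret I: additive_subgroup I E using I by (simp add: left_ideal_def)
    have Il: "r \<otimes>\<^bsub>E\<^esub> x \<in> I" if "r \<in> carrier E" "x \<in> I" for r x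
      using I that by (simp add: left_ideal_def)
    obtain h where h: "h \<in> I" "h \<notin> ?M" using I by blast
    have hE: "h \<in> carrier E" using h I.a_Hcarr by simp
    then obtain d where d: "d \<in> C" "lev d = lev c" "\<not> int p dvd \<kappa> d (h (b c))"
      using h by (auto simp: level_annihilator_def)
    have "coprime (int p) (\<kappa> d (h (b c)))" using d prime_int_p by (simp add: prime_imp_coprime)
    then have "coprime (\<kappa> d (h (b c))) (Q c)" by (simp add: coprime_commute)
    then obtain u where u: "[\<kappa> d (h (b c)) * u = 1] (mod Q c)"
      using cong_solve_coprime_int by blast
    define y where "y = b c [^] u"
    have y: "y \<in> carrier G" "y [^] Q d = \<one>"
      using bc b_pow_one[OF c, of "u * Q d"] d by (auto simp: y_def int_pow_pow)
    have eE: "elem d y \<in> carrier E" using d y by (intro elem_in_E)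
    have hb: "h (b c) \<in> carrier G" using End_ring_carrierD(1)[OF hE bc] .
    have "(elem d y \<otimes>\<^bsub>E\<^esub> h) (b c) = b c [^] (\<kappa> d (h (b c)) * u)"
      using bc hb by (simp add: End_ring_apply elem_apply y_def int_pow_pow mult.commute)
    also have "\<dots> = b c [^] (1::int)"
      using bc b_pow_one[OF c dvd_refl] u by (rule pow_cong)
    also have "\<dots> = b c" using bc by simp
    finally have ehb: "(elem d y \<otimes>\<^bsub>E\<^esub> h) (b c) = b c" .
    \<comment> \<open>\<open>?r\<close> is 1 minus the product of \<open>elem d y\<close> and
      \<open>h\<close>; the negation is written as a factor so that the value at \<open>b c\<close>
      can be computed pointwise.\<close>
    let ?r = "\<one>\<^bsub>E\<^esub> \<oplus>\<^bsub>E\<^esub> (\<ominus>\<^bsub>E\<^esub> \<one>\<^bsub>E\<^esub>) \<otimes>\<^bsub>E\<^esub> (elem d y \<otimes>\<^bsub>E\<^esub> h)"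
    have rE: "?r \<in> carrier E" using eE hE by simp
    have eh: "elem d y \<otimes>\<^bsub>E\<^esub> h \<in> I" using Il eE h by simp
    have "(\<one>\<^bsub>E\<^esub> \<oplus>\<^bsub>E\<^esub> (\<ominus>\<^bsub>E\<^esub> \<one>\<^bsub>E\<^esub>)) (b c) = \<one>"
      by (simp only: E.r_neg E.one_closed) (simp add: End_ring_apply bc)
    then have "?r (b c) = \<one>"
      using bc ehb by (simp add: End_ring_apply)
    then have "int p dvd \<kappa> k (?r (b c))" if "k \<in> C" for k
      using \<kappa>_one[OF that] p_dvd_Q[OF that] by (auto simp: cong_0_iff intro: dvd_trans)
    then have "?r \<in> ?M" using rE by (simp add: level_annihilator_def)
    then have "?r \<in> I" using I by blast
    then have "?r \<oplus>\<^bsub>E\<^esub> elem d y \<otimes>\<^bsub>E\<^esub> h \<in> I" using eh I.a_closed by blast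
    moreover have "?r \<oplus>\<^bsub>E\<^esub> elem d y \<otimes>\<^bsub>E\<^esub> h = \<one>\<^bsub>E\<^esub>"
      using eE hE by (simp add: E.l_minus E.a_assoc E.l_neg)
    ultimately have "\<one>\<^bsub>E\<^esub> \<in> I" by simp
    then have "carrier E \<subseteq> I" using Il[of _ "\<one>\<^bsub>E\<^esub>"] by fastforce
    then show ?thesis using I.a_subset by blast
  qed
  ultimately show ?thesis unfolding maximal_left_ideal_def by (metis E.one_closed)
qed

text \<open>A nilpotent ideal lies in every maximal left ideal; for the reverse inclusion the ideals
  \<open>level_annihilator c\<close> suffice.\<close>

theorem jacobson_radical_eq_rad: "jacobson_radical E = rad"
proof
  show "rad \<subseteq> jacobson_radical E"
    using upper_annihilating_rad_top E.nilpotent_ideal_subset_jacobson_radical[OF rad_ideal] by blast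
  show "jacobson_radical E \<subseteq> rad"
  proof
    fix f assume f: "f \<in> jacobson_radical E"
    then have "f \<in> carrier E" "\<And>c. c \<in> C \<Longrightarrow> f \<in> level_annihilator c"
      using maximal_level_annihilator by (auto simp: jacobson_radical_def)
    then show "f \<in> rad" by (auto simp: rad_def level_annihilator_def)
  qed
qed

end

section \<open>The group \<open>\<Delta>(G)\<close>\<close>

lemma upper_central_subset:
  assumes "group H"
  shows "upper_central H t \<subseteq> carrier H"
proof -
  interpret group H by fact
  show ?thesis by (cases t) auto
qed

section \<open>The group \<open>1 + rad\<close>, its class and coverings by
  \<open>(1 + J_t) Z\<close>\<close>

context p_group_basis
begin

abbreviation UA :: "nat \<Rightarrow> ('a \<Rightarrow> 'a) set" where
  "UA t \<equiv> upper_annihilating E rad t"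

lemma UA_subset_rad: "UA t \<subseteq> rad"
  by (rule E.upper_annihilating_subset[OF rad_ideal])

lemma carrier_Delta: "carrier (Delta G) = one_plus E rad"
  by (simp add: Delta_def jacobson_radical_eq_rad)

lemma one_Delta: "\<one>\<^bsub>Delta G\<^esub> = \<one>\<^bsub>E\<^esub>"
  by (simp add: Delta_def AutoGroup_def BijGroup_def End_ring_def)

lemma one_plus_rad_subset: "one_plus E rad \<subseteq> carrier E"
  using rad_subset by (auto simp: one_plus_def)

text \<open>If \<open>y x = 1\<close> and \<open>z y = 1\<close> then \<open>z = x\<close>, so
  \<open>y\<close> inverts \<open>x\<close> on both sides. Bijectivity gives access to the
  multiplication of \<open>AutoGroup\<close>.\<close>

lemma one_plus_rad_Bij: "one_plus E rad \<subseteq> Bij (carrier G)"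
proof
  fix x assume x: "x \<in> one_plus E rad"
  obtain N where N: "UA N = rad" using upper_annihilating_rad_top by blast
  have left_inv: "\<exists>y\<in>one_plus E rad. y \<otimes>\<^bsub>E\<^esub> x = \<one>\<^bsub>E\<^esub>" if "x \<in> one_plus E rad" for x
  proof -
    obtain a where a: "a \<in> rad" "x = \<one>\<^bsub>E\<^esub> \<oplus>\<^bsub>E\<^esub> a" using \<open>x \<in> one_plus E rad\<close> by (auto simp: one_plus_def)
    from E.one_plus_left_inverse[OF rad_ideal N a(1)] obtain y
      where "y \<in> rad" "(\<one>\<^bsub>E\<^esub> \<oplus>\<^bsub>E\<^esub> y) \<otimes>\<^bsub>E\<^esub> (\<one>\<^bsub>E\<^esub> \<oplus>\<^bsub>E\<^esub> a) = \<one>\<^bsub>E\<^esub>" .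
    then show ?thesis using a by (auto simp: one_plus_def)
  qed
  obtain y where y: "y \<in> one_plus E rad" "y \<otimes>\<^bsub>E\<^esub> x = \<one>\<^bsub>E\<^esub>" using left_inv[OF x] by blast
  obtain z where z: "z \<in> one_plus E rad" "z \<otimes>\<^bsub>E\<^esub> y = \<one>\<^bsub>E\<^esub>" using left_inv[OF y(1)] by blast
  have c: "x \<in> carrier E" "y \<in> carrier E" "z \<in> carrier E"
    using x y z one_plus_rad_subset by auto
  have "z = z \<otimes>\<^bsub>E\<^esub> (y \<otimes>\<^bsub>E\<^esub> x)" using c y by simp
  also have "\<dots> = x" using c z by (simp flip: E.m_assoc)
  finally have xy: "x \<otimes>\<^bsub>E\<^esub> y = \<one>\<^bsub>E\<^esub>" using z by simp
  have "y (x g) = g" "x (y g) = g" if "g \<in> carrier G" for g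
    using fun_cong[OF y(2), of g] fun_cong[OF xy, of g] that by (simp_all add: End_ring_apply)
  then have "bij_betw x (carrier G) (carrier G)"
    using End_ring_carrierD(1)[OF c(1)] End_ring_carrierD(1)[OF c(2)]
    by (intro bij_betw_byWitness[where f' = y]) auto
  then show "x \<in> Bij (carrier G)" using End_ring_carrierD(4)[OF c(1)] by (simp add: Bij_def)
qed

lemma mult_Delta:
  assumes "x \<in> carrier (Delta G)" "y \<in> carrier (Delta G)"
  shows "x \<otimes>\<^bsub>Delta G\<^esub> y = x \<otimes>\<^bsub>E\<^esub> y"
proof -
  have "x \<in> Bij (carrier G)" "y \<in> Bij (carrier G)"
    using assms one_plus_rad_Bij carrier_Delta by auto
  then show ?thesis by (simp add: Delta_def AutoGroup_def BijGroup_def End_ring_def)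
qed

lemma group_Delta: "group (Delta G)"
  using upper_annihilating_rad_top E.group_one_plus[OF rad_ideal _ carrier_Delta one_Delta mult_Delta]
  by blast

lemma Delta_nilpotent: "upper_central (Delta G) (nilpotency_class (Delta G)) = carrier (Delta G)"
proof -
  obtain N where N: "UA N = rad" using upper_annihilating_rad_top by blast
  have "carrier (Delta G) \<subseteq> upper_central (Delta G) N"
    using E.one_plus_upper_annihilating_subset_upper_central[OF rad_ideal N carrier_Delta one_Delta mult_Delta, of N]
    by (simp add: N carrier_Delta)
  then have "upper_central (Delta G) N = carrier (Delta G)"
    using upper_central_subset[OF group_Delta] by blast
  then show ?thesis unfolding nilpotency_class_def by (rule LeastI)
qed

text \<open>Class 0 is separated because the (uas)-(ucs) condition begins at
  \<open>t = 1\<close>.\<close>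

lemma nilpotency_class_0_iff: "nilpotency_class (Delta G) = 0 \<longleftrightarrow> rad = {\<zero>\<^bsub>E\<^esub>}"
proof
  assume "nilpotency_class (Delta G) = 0"
  then have "one_plus E rad = {\<one>\<^bsub>E\<^esub>}"
    using Delta_nilpotent by (simp add: carrier_Delta one_Delta)
  then have "\<one>\<^bsub>E\<^esub> \<oplus>\<^bsub>E\<^esub> a = \<one>\<^bsub>E\<^esub>" if "a \<in> rad" for a
    using that unfolding one_plus_def by blast
  then have "a = \<zero>\<^bsub>E\<^esub>" if "a \<in> rad" for a
    using that rad_subset E.add.l_cancel_one[of "\<one>\<^bsub>E\<^esub>" a] by auto
  moreover have "\<zero>\<^bsub>E\<^esub> \<in> rad"
    using additive_subgroup.zero_closed[OF ideal.axioms(1)[OF rad_ideal]] .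
  ultimately show "rad = {\<zero>\<^bsub>E\<^esub>}" by blast
next
  assume "rad = {\<zero>\<^bsub>E\<^esub>}"
  then have "upper_central (Delta G) 0 = carrier (Delta G)"
    by (simp add: carrier_Delta one_Delta one_plus_def)
  then show "nilpotency_class (Delta G) = 0"
    unfolding nilpotency_class_def by (rule Least_eq_0)
qed

text \<open>The nontrivial inclusion of \<open>1 + J = (1 + J_t) Z\<close>, with products in the
  ring rather than in \<open>Delta G\<close>, so that it can be read entry by entry.\<close>

definition covered :: "nat \<Rightarrow> bool" where
  "covered t \<longleftrightarrow>
     (\<forall>a\<in>rad. \<exists>u\<in>UA t. \<exists>z\<in>ring_center E \<inter> one_plus E rad.
        \<one>\<^bsub>E\<^esub> \<oplus>\<^bsub>E\<^esub> a = (\<one>\<^bsub>E\<^esub> \<oplus>\<^bsub>E\<^esub> u) \<otimes>\<^bsub>E\<^esub> z)"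

lemma covered_iff:
  "covered t \<longleftrightarrow> carrier (Delta G) \<subseteq>
     one_plus E (UA t) <#>\<^bsub>Delta G\<^esub> (ring_center E \<inter> carrier (Delta G))"
proof -
  have "(\<one>\<^bsub>E\<^esub> \<oplus>\<^bsub>E\<^esub> u) \<otimes>\<^bsub>Delta G\<^esub> z = (\<one>\<^bsub>E\<^esub> \<oplus>\<^bsub>E\<^esub> u) \<otimes>\<^bsub>E\<^esub> z"
    if "u \<in> UA t" "z \<in> ring_center E \<inter> one_plus E rad" for u z
    using that UA_subset_rad by (intro mult_Delta) (auto simp: carrier_Delta one_plus_def)
  then have eq: "one_plus E (UA t) <#>\<^bsub>Delta G\<^esub> (ring_center E \<inter> one_plus E rad)
    = {(\<one>\<^bsub>E\<^esub> \<oplus>\<^bsub>E\<^esub> u) \<otimes>\<^bsub>E\<^esub> z | u z. u \<in> UA t \<and> z \<in> ring_center E \<inter> one_plus E rad}"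
    by (fastforce simp: set_mult_def carrier_Delta one_plus_def)
  show ?thesis
    unfolding covered_def carrier_Delta eq by (subst (2) one_plus_def) blast
qed

lemma covered_nilpotency_class:
  assumes "uas_ucs_Delta G" "0 < nilpotency_class (Delta G)"
  shows "covered (nilpotency_class (Delta G))"
proof -
  have "nilpotency_class (Delta G) \<in> {1..nilpotency_class (Delta G)}" using assms(2) by simp
  then show ?thesis
    using assms(1) Delta_nilpotent
    unfolding covered_iff uas_ucs_Delta_def jacobson_radical_eq_rad by blast
qed

lemma not_covered_below_nilpotency_class:
  assumes "uas_ucs_Delta G" "0 < t" "t < nilpotency_class (Delta G)"
  shows "\<not> covered t"
proof
  assume c: "covered t"
  have t: "t \<in> {1..nilpotency_class (Delta G)}" using assms by simp
  have "upper_central (Delta G) t =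
      one_plus E (UA t) <#>\<^bsub>Delta G\<^esub> (ring_center E \<inter> carrier (Delta G))"
    using assms(1) t unfolding uas_ucs_Delta_def jacobson_radical_eq_rad by blast
  then have "upper_central (Delta G) t = carrier (Delta G)"
    using c upper_central_subset[OF group_Delta, of t] unfolding covered_iff by simp
  then show False
    using assms(3) not_less_Least unfolding nilpotency_class_def by blast
qed

lemma covered_if_UA_eq_rad:
  assumes "UA t = rad"
  shows "covered t"
  unfolding covered_def
proof
  fix a assume a: "a \<in> rad"
  have "\<zero>\<^bsub>E\<^esub> \<in> rad"
    using additive_subgroup.zero_closed[OF ideal.axioms(1)[OF rad_ideal]] .
  then have "\<one>\<^bsub>E\<^esub> \<in> one_plus E rad"
    unfolding one_plus_def by (intro image_eqI[of _ _ "\<zero>\<^bsub>E\<^esub>"]) auto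
  then have "\<one>\<^bsub>E\<^esub> \<in> ring_center E \<inter> one_plus E rad" by (simp add: ring_center_def)
  then show "\<exists>u\<in>UA t. \<exists>z\<in>ring_center E \<inter> one_plus E rad.
      \<one>\<^bsub>E\<^esub> \<oplus>\<^bsub>E\<^esub> a = (\<one>\<^bsub>E\<^esub> \<oplus>\<^bsub>E\<^esub> u) \<otimes>\<^bsub>E\<^esub> z"
    using a assms rad_subset by (intro bexI[of _ a] bexI[of _ "\<one>\<^bsub>E\<^esub>"]) auto
qed

section \<open>What a covering says about the matrix entries\<close>

lemma ex_top: "\<exists>m\<in>C. lev m = s"
  using ex_lev s_ge_1 by simp

text \<open>Central elements are scalars, so the factorisation becomes
  \<open>1 + A = k (1 + U)\<close> for matrices; \<open>\<kappa> d (b c)\<close> stands for the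
  entry of the identity.\<close>

lemma covered_entries:
  assumes "covered t" "a \<in> rad"
  obtains u k where "u \<in> UA t"
    "\<And>c d. c \<in> C \<Longrightarrow> d \<in> C \<Longrightarrow>
      [\<kappa> d (b c) + \<kappa> d (a (b c)) = k * (\<kappa> d (b c) + \<kappa> d (u (b c)))] (mod Q d)"
proof -
  obtain u z where uz: "u \<in> UA t" "z \<in> ring_center E"
    and eq: "\<one>\<^bsub>E\<^esub> \<oplus>\<^bsub>E\<^esub> a = (\<one>\<^bsub>E\<^esub> \<oplus>\<^bsub>E\<^esub> u) \<otimes>\<^bsub>E\<^esub> z"
    using assms unfolding covered_def by blast
  obtain k where z: "z = scalar k" using ex_top central_is_scalar uz(2) by blast
  have aE: "a \<in> carrier E" and uE: "u \<in> carrier E"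
    using assms(2) uz(1) rad_subset UA_subset_rad by blast+
  have "[\<kappa> d (b c) + \<kappa> d (a (b c)) = k * (\<kappa> d (b c) + \<kappa> d (u (b c)))] (mod Q d)"
    if c: "c \<in> C" and d: "d \<in> C" for c d
  proof -
    note bc = b_carrier[OF c]
    note ab = End_ring_carrierD(1)[OF aE bc] and ub = End_ring_carrierD(1)[OF uE bc]
    have "b c \<otimes> a (b c) = b c [^] k \<otimes> u (b c [^] k)"
      using fun_cong[OF eq, of "b c"] bc by (simp add: End_ring_apply z scalar_apply)
    also have "\<dots> = (b c \<otimes> u (b c)) [^] k"
      using End_int_pow[OF uE bc] bc ub by (simp add: int_pow_distrib)
    finally have "[\<kappa> d (b c) + \<kappa> d (a (b c)) = \<kappa> d ((b c \<otimes> u (b c)) [^] k)] (mod Q d)"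
      using \<kappa>_mult[OF d bc ab] by (simp add: cong_sym)
    also have "[\<kappa> d ((b c \<otimes> u (b c)) [^] k) = k * \<kappa> d (b c \<otimes> u (b c))] (mod Q d)"
      using \<kappa>_int_pow d bc ub by simp
    also have "[k * \<kappa> d (b c \<otimes> u (b c)) = k * (\<kappa> d (b c) + \<kappa> d (u (b c)))] (mod Q d)"
      by (rule cong_scalar_left[OF \<kappa>_mult[OF d bc ub]])
    finally show ?thesis .
  qed
  then show ?thesis using that uz(1) by blast
qed

lemma p_power_dvd_iff: "int p ^ i dvd int p ^ j \<longleftrightarrow> i \<le> j"
  using p_gt_1 by (simp add: dvd_power_iff)

text \<open>Tested on the multiple of a matrix unit with entry \<open>p ^ wt c d\<close>. The
  identity contributes nothing at this position, so \<open>p ^ wt c d\<close> is \<open>k\<close>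
  times the entry of \<open>u\<close>, and a power of p killing the latter kills the former.\<close>

lemma covered_off_diagonal:
  assumes "covered t" "c \<in> C" "d \<in> C" "lev c \<noteq> lev d"
  shows "n (lev d) \<le> \<alpha> c d t + wt c d"
proof -
  let ?y = "b d [^] int p ^ wt c d"
  have y: "?y \<in> carrier G" using b_carrier assms by simp
  obtain u k where u: "u \<in> UA t"
    and ent: "\<And>c' d'. c' \<in> C \<Longrightarrow> d' \<in> C \<Longrightarrow> [\<kappa> d' (b c') + \<kappa> d' (elem c ?y (b c'))
        = k * (\<kappa> d' (b c') + \<kappa> d' (u (b c')))] (mod Q d')"
    using covered_entries[OF assms(1) elem_wt_in_rad[OF assms(2,3)]] by blast
  have zero: "[\<kappa> d (b c) = 0] (mod Q d)" using \<kappa>_b[OF assms(3,2)] assms(4) by (metis (full_types))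
  have "[\<kappa> d ?y = int p ^ wt c d * \<kappa> d (b d)] (mod Q d)"
    using \<kappa>_int_pow assms(3) b_carrier by simp
  also have "[int p ^ wt c d * \<kappa> d (b d) = int p ^ wt c d * 1] (mod Q d)"
    using \<kappa>_b[OF assms(3,3)] by (intro cong_scalar_left) simp
  finally have "[0 + int p ^ wt c d = \<kappa> d (b c) + \<kappa> d ?y] (mod Q d)"
    using zero by (intro cong_add) (auto intro: cong_sym)
  also have "[\<kappa> d (b c) + \<kappa> d ?y = k * (\<kappa> d (b c) + \<kappa> d (u (b c)))] (mod Q d)"
    using ent[OF assms(2,3)] elem_b[OF assms(2) y b_pow_wt[OF assms(2,3)] assms(2)] by simp
  also have "[k * (\<kappa> d (b c) + \<kappa> d (u (b c))) = k * (0 + \<kappa> d (u (b c)))] (mod Q d)"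
    using zero by (intro cong_scalar_left cong_add) auto
  finally have "[int p ^ wt c d = k * \<kappa> d (u (b c))] (mod Q d)" by simp
  moreover have "Q d dvd int p ^ \<alpha> c d t * (k * \<kappa> d (u (b c)))"
    using upper_annihilating_rad_iff[of u t] u UA_subset_rad assms(2,3)
    by (subst mult.left_commute) (blast intro: dvd_mult)
  ultimately have "Q d dvd int p ^ \<alpha> c d t * int p ^ wt c d"
    using cong_dvd_mult_iff[OF _ dvd_refl] by blast
  then show ?thesis by (simp add: p_power_dvd_iff flip: power_add)
qed

text \<open>Cut down to the summand of \<open>m\<close>, multiplication by p has p as its single
  entry, and the assumption kills it; centrality spreads this to all of \<open>G\<close>. It stands
  in for an estimate of the upper function on lower levels.\<close>

lemma scalar_p_in_UA:
  assumes tp: "lev m = s" "m \<in> C" and le: "n s \<le> \<alpha> m m t + 1"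
  shows "scalar (int p) \<in> UA t"
proof -
  have bm: "b m \<in> carrier G" using b_carrier tp by simp
  note em = elem_in_E[OF tp(2) bm exponent_top[OF tp bm]]
  note em_b = elem_b[OF tp(2) bm exponent_top[OF tp bm]]
  have pr: "scalar (int p) \<in> rad" by (simp add: scalar_in_rad)
  have per: "scalar (int p) \<otimes>\<^bsub>E\<^esub> elem m (b m) \<in> rad"
    using ideal.I_r_closed[OF rad_ideal pr em] .
  have "Q d dvd int p ^ \<alpha> c d t * \<kappa> d ((scalar (int p) \<otimes>\<^bsub>E\<^esub> elem m (b m)) (b c))"
    if c: "c \<in> C" and d: "d \<in> C" for c d
  proof (cases "c = m")
    case True
    have "(scalar (int p) \<otimes>\<^bsub>E\<^esub> elem m (b m)) (b c) = b m [^] int p"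
      using True em_b[OF tp(2)] bm by (simp add: End_ring_apply scalar_apply)
    moreover have "Q d dvd int p ^ \<alpha> c d t * \<kappa> d (b m [^] int p)"
    proof -
      have "[\<kappa> d (b m [^] int p) = int p * \<kappa> d (b m)] (mod Q d)" using \<kappa>_int_pow d bm by simp
      also have "[int p * \<kappa> d (b m) = int p * (if d = m then 1 else 0)] (mod Q d)"
        using \<kappa>_b[OF d tp(2)] by (rule cong_scalar_left)
      finally have "[\<kappa> d (b m [^] int p) = int p * (if d = m then 1 else 0)] (mod Q d)" .
      moreover have "Q d dvd int p ^ \<alpha> c d t * (int p * (if d = m then 1 else 0))"
      proof (cases "d = m")
        case True
        have "Q d dvd int p ^ (\<alpha> m m t + 1)" using le True tp by (intro le_imp_power_dvd) simp
        then show ?thesis using True \<open>c = m\<close> by (simp add: mult.commute)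
      qed simp
      ultimately show ?thesis using cong_dvd_mult_iff[OF _ dvd_refl] by blast
    qed
    ultimately show ?thesis by simp
  next
    case False
    have "(scalar (int p) \<otimes>\<^bsub>E\<^esub> elem m (b m)) (b c) = \<one>"
      using False em_b[OF c] b_carrier[OF c] by (simp add: End_ring_apply scalar_apply)
    then show ?thesis using \<kappa>_one[OF d] by (simp add: cong_0_iff)
  qed
  then have "scalar (int p) \<otimes>\<^bsub>E\<^esub> elem m (b m) \<in> UA t"
    using upper_annihilating_rad_iff[OF per] by blast
  then show ?thesis
    using E.central_in_upper_annihilating[OF rad_ideal scalar_central pr em top_faithful[OF tp]] by blast
qed

text \<open>A scalar can correct the diagonal entry at only one of two distinct basis elements.\<close>

lemma covered_diagonal:
  assumes cov: "covered t" and tp: "lev m = s" "m \<in> C" and c: "c \<in> C" "c \<noteq> m"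
  shows "n (lev c) \<le> \<alpha> c c t + 1"
\<comment> \<open>If the bound holds at the top position, \<open>scalar_p_in_UA\<close> passes it on
  to \<open>c\<close>. If it fails at both positions, \<open>k\<close> is forced to two values
  modulo \<open>p ^ 2\<close>.\<close>
proof (cases "n s \<le> \<alpha> m m t + 1")
  case True
  have sp: "scalar (int p) \<in> rad" by (simp add: scalar_in_rad)
  have bc: "b c \<in> carrier G" using b_carrier c by simp
  have "Q c dvd int p ^ \<alpha> c c t * \<kappa> c (b c [^] int p)"
    using upper_annihilating_rad_iff[OF sp, of t] scalar_p_in_UA[OF tp True] c bc
    by (force simp: scalar_apply)
  moreover have "[\<kappa> c (b c [^] int p) = int p * 1] (mod Q c)"
    using cong_trans[OF \<kappa>_int_pow[OF c(1) bc] cong_scalar_left[OF \<kappa>_b[OF c(1,1)]]] by simp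
  ultimately have "Q c dvd int p ^ \<alpha> c c t * (int p * 1)"
    using cong_dvd_mult_iff[OF _ dvd_refl] by blast
  then have "int p ^ n (lev c) dvd int p ^ (\<alpha> c c t + 1)" by (simp add: mult.commute)
  then show ?thesis unfolding p_power_dvd_iff .
next
  case m_small: False
  show ?thesis
  proof (rule ccontr)
    assume c_small: "\<not> n (lev c) \<le> \<alpha> c c t + 1"
    let ?y = "b c [^] int p ^ wt c c"
    have wt1: "wt c c = 1" by (simp add: step_weight_def)
    have bc: "b c \<in> carrier G" and y: "?y \<in> carrier G" using b_carrier c by auto
    note elem_b' = elem_b[OF c(1) y b_pow_wt[OF c(1,1)]]
    obtain u k where u: "u \<in> UA t"
      and ent: "\<And>c' d'. c' \<in> C \<Longrightarrow> d' \<in> C \<Longrightarrow> [\<kappa> d' (b c') + \<kappa> d' (elem c ?y (b c'))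
          = k * (\<kappa> d' (b c') + \<kappa> d' (u (b c')))] (mod Q d')"
      using covered_entries[OF cov elem_wt_in_rad[OF c(1,1)]] by blast
    \<comment> \<open>Failure at \<open>d\<close> means that \<open>p ^ (\<alpha> d d t + 2)\<close>
      divides \<open>Q d\<close>; hence \<open>p ^ 2\<close> divides the diagonal entry of
      \<open>u\<close>, and \<open>k\<close> agrees with the diagonal entry of
      \<open>1 + elem c ?y\<close> modulo \<open>p ^ 2\<close>.\<close>
    have k_cong: "[1 + \<kappa> d (elem c ?y (b d)) = k] (mod int p ^ 2)"
      if d: "d \<in> C" "\<not> n (lev d) \<le> \<alpha> d d t + 1" for d
    proof -
      have "Q d dvd int p ^ \<alpha> d d t * \<kappa> d (u (b d))"
        using upper_annihilating_rad_iff[of u t] u UA_subset_rad d(1) by blast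
      moreover have "int p ^ (\<alpha> d d t + 2) dvd Q d" using d(2) by (intro le_imp_power_dvd) simp
      ultimately have "int p ^ \<alpha> d d t * int p ^ 2 dvd int p ^ \<alpha> d d t * \<kappa> d (u (b d))"
        unfolding power_add by (rule dvd_trans[rotated])
      then have u0: "[\<kappa> d (u (b d)) = 0] (mod int p ^ 2)"
        using p_gt_1 by (simp add: cong_0_iff)
      have p2: "int p ^ 2 dvd Q d" using d(2) by (intro le_imp_power_dvd) simp
      have b1: "[\<kappa> d (b d) = 1] (mod int p ^ 2)"
        using \<kappa>_b[OF d(1,1)] p2 by (auto intro: cong_dvd_modulus)
      have "[1 + \<kappa> d (elem c ?y (b d)) = \<kappa> d (b d) + \<kappa> d (elem c ?y (b d))] (mod int p ^ 2)"
        using b1 by (intro cong_add) (auto intro: cong_sym)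
      also have "[\<kappa> d (b d) + \<kappa> d (elem c ?y (b d)) = k * (\<kappa> d (b d) + \<kappa> d (u (b d)))] (mod int p ^ 2)"
        using ent[OF d(1,1)] p2 by (rule cong_dvd_modulus)
      also have "[k * (\<kappa> d (b d) + \<kappa> d (u (b d))) = k * (1 + 0)] (mod int p ^ 2)"
        using b1 u0 by (intro cong_scalar_left cong_add)
      finally show ?thesis by simp
    qed
    have "[\<kappa> c ?y = int p * \<kappa> c (b c)] (mod Q c)" using \<kappa>_int_pow c bc wt1 by simp
    also have "[int p * \<kappa> c (b c) = int p * 1] (mod Q c)"
      using \<kappa>_b[OF c(1,1)] by (intro cong_scalar_left) simp
    finally have "[\<kappa> c ?y = int p] (mod Q c)" by simp
    then have "[\<kappa> c ?y = int p] (mod int p ^ 2)"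
      using c_small by (elim cong_dvd_modulus) (intro le_imp_power_dvd, simp)
    \<comment> \<open>The test element has diagonal entry p at \<open>c\<close> and 0 at
      \<open>m\<close>, so \<open>k\<close> would be both \<open>1 + p\<close> and 1.\<close>
    then have "[1 + int p = 1 + \<kappa> c (elem c ?y (b c))] (mod int p ^ 2)"
      using elem_b'[OF c(1)] by (intro cong_add) (auto intro: cong_sym)
    also have "[1 + \<kappa> c (elem c ?y (b c)) = k] (mod int p ^ 2)"
      using k_cong[OF c(1) c_small] .
    also have "[k = 1 + \<kappa> m (elem c ?y (b m))] (mod int p ^ 2)"
      using m_small tp(1) by (intro cong_sym[OF k_cong[OF tp(2)]]) simp
    also have "[1 + \<kappa> m (elem c ?y (b m)) = 1 + 0] (mod int p ^ 2)"
    proof (intro cong_add cong_refl)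
      have "int p ^ 2 dvd Q m" using m_small tp(1) by (intro le_imp_power_dvd) simp
      then show "[\<kappa> m (elem c ?y (b m)) = 0] (mod int p ^ 2)"
        using elem_b'[OF tp(2)] c(2) \<kappa>_one[OF tp(2)] by (auto intro: cong_dvd_modulus)
    qed
    finally have "int p ^ 2 dvd int p ^ 1" by (simp add: cong_iff_dvd_diff)
    then show False unfolding p_power_dvd_iff by simp
  qed
qed

lemma rad_entry_killed:
  assumes "a \<in> rad" "c \<in> C" "d \<in> C" "n (lev d) \<le> \<alpha> c d t + wt c d"
  shows "Q d dvd int p ^ \<alpha> c d t * \<kappa> d (a (b c))"
proof -
  have "Q d dvd int p ^ (\<alpha> c d t + wt c d)" using assms(4) by (rule le_imp_power_dvd)
  also have "\<dots> dvd int p ^ \<alpha> c d t * \<kappa> d (a (b c))"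
    unfolding power_add using wt_dvd_entry[OF assms(1-3)] by simp
  finally show ?thesis .
qed

text \<open>Every basis element differs from \<open>m\<close> or from \<open>m'\<close>, so
  \<open>covered_diagonal\<close> leaves no exceptional position.\<close>

lemma covered_imp_UA_eq_rad:
  assumes cov: "covered t" and m: "m \<in> C" "lev m = s" and m': "m' \<in> C" "lev m' = s" "m \<noteq> m'"
  shows "UA t = rad"
proof -
  have "n (lev d) \<le> \<alpha> c d t + wt c d" if c: "c \<in> C" and d: "d \<in> C" for c d
  proof (cases "lev c = lev d")
    case True
    have "n (lev c) \<le> \<alpha> c c t + 1"
      using covered_diagonal[OF cov m(2,1) c] covered_diagonal[OF cov m'(2,1) c] m'(3) by blast
    then show ?thesis using True by (simp add: step_weight_def)
  qed (use covered_off_diagonal[OF cov c d] in simp)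
  then have "a \<in> UA t" if "a \<in> rad" for a
    using upper_annihilating_rad_iff[OF that] rad_entry_killed[OF that] by blast
  then show ?thesis using UA_subset_rad by blast
qed

theorem nilpotency_class_eq_annihilating_length:
  assumes uas: "uas_ucs_Delta G"
    and m: "m \<in> C" "lev m = s" and m': "m' \<in> C" "lev m' = s" "m \<noteq> m'"
  shows "nilpotency_class (Delta G) = annihilating_length E rad"
  unfolding annihilating_length_def
proof (rule Least_equality[symmetric])
  show "UA (nilpotency_class (Delta G)) = rad"
  \<comment> \<open>The covering is available only for positive class; class 0 means that
    \<open>rad\<close> is zero, which is \<open>UA 0\<close>.\<close>
  proof (cases "nilpotency_class (Delta G) = 0")
    case True
    then show ?thesis using nilpotency_class_0_iff by simp
  next
    case False
    then show ?thesis using covered_imp_UA_eq_rad[OF covered_nilpotency_class[OF uas] m m'] by simp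
  qed
  fix t assume t: "UA t = rad"
  show "nilpotency_class (Delta G) \<le> t"
  proof (cases "t = 0")
    case True
    then show ?thesis using nilpotency_class_0_iff t by simp
  next
    case False
    then show ?thesis
      using not_covered_below_nilpotency_class[OF uas, of t] covered_if_UA_eq_rad[OF t] by force
  qed
qed

text \<open>\<open>f_rad\<close> is \<open>n (lev d) - wt c d\<close>, the exponent needed to kill
  the generator \<open>p ^ wt c d\<close> modulo \<open>Q d\<close>; off the diagonal this is the
  smaller of the two exponents.\<close>

lemma f_rad_le_iff:
  assumes c: "c \<in> C" and d: "d \<in> C"
  shows "f_rad n (lev c) (lev d) \<le> k \<longleftrightarrow> n (lev d) \<le> k + wt c d"
  using n_le_iff[OF c d] n_le_iff[OF d c] by (auto simp: f_rad_def step_weight_def min_def)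

text \<open>One direction collects the bounds above. For the other, dividing \<open>1 + a\<close> by
  its own diagonal entry at \<open>m\<close> clears the one position on which nothing is
  assumed.\<close>

lemma covered_iff_f_rad:
  assumes tp: "m \<in> C" "lev m = s" and unique: "\<And>c. c \<in> C \<Longrightarrow> lev c = s \<Longrightarrow> c = m"
  shows "covered t \<longleftrightarrow> (\<forall>(i, j) \<in> {1..s} \<times> {1..s} - {(s, s)}. f_rad n i j \<le> upper_fun n s i j t)"
    (is "_ \<longleftrightarrow> ?R")
proof
  assume cov: "covered t"
  have le: "f_rad n i j \<le> upper_fun n s i j t" if ij: "i \<in> {1..s}" "j \<in> {1..s}" "(i, j) \<noteq> (s, s)" for i j
  proof -
    obtain c where c: "c \<in> C" "lev c = i" using ex_lev ij by blast
    obtain d where d: "d \<in> C" "lev d = j" using ex_lev ij by blast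
    have "n (lev d) \<le> \<alpha> c d t + wt c d"
    proof (cases "i = j")
      case True
      then have "c \<noteq> m" using ij c tp by auto
      then show ?thesis
        using covered_diagonal[OF cov tp(2,1) c(1)] c d True by (simp add: step_weight_def)
    qed (use covered_off_diagonal[OF cov c(1) d(1)] c d in simp)
    then show ?thesis using f_rad_le_iff[OF c(1) d(1)] c d by simp
  qed
  show ?R by (auto intro!: le)
next
  assume R: ?R
  interpret rad: ideal rad E by (rule rad_ideal)
  have bm: "b m \<in> carrier G" using b_carrier tp by simp
  show "covered t"
    unfolding covered_def
  proof
    fix a assume a: "a \<in> rad"
    have aE: "a \<in> carrier E" using a rad_subset by blast
    \<comment> \<open>Diagonal entry of \<open>1 + a\<close> at \<open>m\<close>: congruent to 1
      modulo p, hence a unit modulo \<open>Q m\<close>, and \<open>Q m\<close> kills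
      \<open>G\<close>.\<close>
    define k where "k = 1 + \<kappa> m (a (b m))"
    have "int p dvd \<kappa> m (a (b m))" using a tp(1) unfolding rad_def by blast
    then have pk: "int p dvd k - 1" by (simp add: k_def)
    have "\<not> int p dvd k"
    proof
      assume "int p dvd k"
      then have "int p dvd k - (k - 1)" using pk dvd_diff by blast
      then show False using p_gt_1 by simp
    qed
    then have "coprime (int p) k" by (rule prime_imp_coprime[OF prime_int_p])
    then have "coprime k (Q m)" by (simp add: coprime_commute)
    then obtain k' where k': "[k * k' = 1] (mod Q m)" using cong_solve_coprime_int by blast
    have "int p dvd k * k' - 1"
      using k' p_dvd_Q[OF tp(1)] by (auto simp: cong_iff_dvd_diff intro: dvd_trans)
    then have "int p dvd (k * k' - 1) - (k - 1) * k'" by (rule dvd_diff[OF _ dvd_mult2[OF pk]])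
    then have pk': "int p dvd k' - 1" by (simp add: algebra_simps)
    \<comment> \<open>\<open>u = k' (1 + a) - 1\<close>, chosen so that
      \<open>1 + a = k (1 + u)\<close>; its diagonal entry at \<open>m\<close> is
      \<open>k k' - 1\<close>, which is 0 modulo \<open>Q m\<close>.\<close>
    define u where "u = scalar (k' - 1) \<oplus>\<^bsub>E\<^esub> scalar k' \<otimes>\<^bsub>E\<^esub> a"
    have uR: "u \<in> rad"
      using scalar_in_rad[OF pk'] a scalar_in_E by (simp add: u_def rad.I_l_closed)
    have uE: "u \<in> carrier E" using uR rad_subset by blast
    have u_apply: "u x = x [^] (k' - 1) \<otimes> a x [^] k'" if "x \<in> carrier G" for x
      using that End_ring_carrierD(1)[OF aE that] by (simp add: u_def End_ring_apply scalar_apply)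
    have "u \<in> UA t"
      unfolding upper_annihilating_rad_iff[OF uR]
    proof (intro ballI)
      fix c d assume c: "c \<in> C" and d: "d \<in> C"
      show "Q d dvd int p ^ \<alpha> c d t * \<kappa> d (u (b c))"
      proof (cases "lev c = s \<and> lev d = s")
        case True
        then have cd: "c = m" "d = m" using c d unique by auto
        note am = End_ring_carrierD(1)[OF aE bm]
        have "[\<kappa> m (u (b m)) = \<kappa> m (b m [^] (k' - 1)) + \<kappa> m (a (b m) [^] k')] (mod Q m)"
          unfolding u_apply[OF bm] using bm am by (intro \<kappa>_mult tp) auto
        also have "[\<kappa> m (b m [^] (k' - 1)) + \<kappa> m (a (b m) [^] k')
            = (k' - 1) * \<kappa> m (b m) + k' * \<kappa> m (a (b m))] (mod Q m)"
          by (intro cong_add \<kappa>_int_pow tp bm am)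
        also have "[(k' - 1) * \<kappa> m (b m) + k' * \<kappa> m (a (b m))
            = (k' - 1) * 1 + k' * \<kappa> m (a (b m))] (mod Q m)"
          using \<kappa>_b[OF tp(1,1)] by (intro cong_add cong_scalar_left cong_refl) simp
        also have "(k' - 1) * 1 + k' * \<kappa> m (a (b m)) = k * k' - 1"
          by (simp add: k_def algebra_simps)
        also have "[k * k' - 1 = 1 - 1] (mod Q m)" using k' by (intro cong_diff) auto
        finally show ?thesis using cd by (simp add: cong_0_iff)
      next
        case False
        then have "f_rad n (lev c) (lev d) \<le> \<alpha> c d t"
          using R lev_in[OF c] lev_in[OF d] by auto
        then show ?thesis using f_rad_le_iff[OF c d] rad_entry_killed[OF uR c d] by simp
      qed
    qed
    moreover have "scalar k \<in> ring_center E \<inter> one_plus E rad"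
    proof -
      have "scalar k = \<one>\<^bsub>E\<^esub> \<oplus>\<^bsub>E\<^esub> scalar (k - 1)"
      proof (rule End_ring_ext)
        fix x assume x: "x \<in> carrier G"
        then have "x [^] k = x [^] (1::int) \<otimes> x [^] (k - 1)" by (simp flip: int_pow_mult del: int_pow_1)
        then show "scalar k x = (\<one>\<^bsub>E\<^esub> \<oplus>\<^bsub>E\<^esub> scalar (k - 1)) x"
          using x by (simp add: End_ring_apply scalar_apply)
      qed (use scalar_in_E in auto)
      then show ?thesis
        using scalar_central[of k] scalar_in_rad[OF pk] unfolding one_plus_def by blast
    qed
    moreover have "\<one>\<^bsub>E\<^esub> \<oplus>\<^bsub>E\<^esub> a = (\<one>\<^bsub>E\<^esub> \<oplus>\<^bsub>E\<^esub> u) \<otimes>\<^bsub>E\<^esub> scalar k"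
    proof (rule End_ring_ext)
      fix x assume x: "x \<in> carrier G"
      note ax = End_ring_carrierD(1)[OF aE x]
      have xk: "x [^] k \<in> carrier G" using x by simp
      have "((\<one>\<^bsub>E\<^esub> \<oplus>\<^bsub>E\<^esub> u) \<otimes>\<^bsub>E\<^esub> scalar k) x
          = x [^] k \<otimes> ((x [^] k) [^] (k' - 1) \<otimes> a (x [^] k) [^] k')"
        using x xk by (simp add: End_ring_apply scalar_apply u_apply)
      also have "\<dots> = (x [^] k \<otimes> (x [^] k) [^] (k' - 1)) \<otimes> a (x [^] k) [^] k'"
        using x xk End_ring_carrierD(1)[OF aE xk] by (simp add: m_assoc)
      also have "x [^] k \<otimes> (x [^] k) [^] (k' - 1) = x [^] (k * k')"
        using x by (simp add: int_pow_pow algebra_simps flip: int_pow_mult)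
      also have "a (x [^] k) [^] k' = a x [^] (k * k')"
        using x ax by (simp add: End_int_pow[OF aE x] int_pow_pow)
      also have "x [^] (k * k') \<otimes> a x [^] (k * k') = (x \<otimes> a x) [^] (k * k')"
        using x ax by (simp add: int_pow_distrib)
      also have "\<dots> = (x \<otimes> a x) [^] (1::int)"
        using x ax exponent_top[OF tp(2,1)] k' by (intro pow_cong) auto
      also have "\<dots> = (\<one>\<^bsub>E\<^esub> \<oplus>\<^bsub>E\<^esub> a) x" using x ax by (simp add: End_ring_apply)
      finally show "(\<one>\<^bsub>E\<^esub> \<oplus>\<^bsub>E\<^esub> a) x = ((\<one>\<^bsub>E\<^esub> \<oplus>\<^bsub>E\<^esub> u) \<otimes>\<^bsub>E\<^esub> scalar k) x" by simp
    qed (use aE uE scalar_in_E in auto)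
    ultimately show "\<exists>u\<in>UA t. \<exists>z\<in>ring_center E \<inter> one_plus E rad.
        \<one>\<^bsub>E\<^esub> \<oplus>\<^bsub>E\<^esub> a = (\<one>\<^bsub>E\<^esub> \<oplus>\<^bsub>E\<^esub> u) \<otimes>\<^bsub>E\<^esub> z" by blast
  qed
qed

text \<open>Multiplication by p lies in \<open>rad\<close>, so it vanishes; then the largest
  exponent is 1, only one level is left, and uniqueness makes \<open>G\<close> cyclic of order p.
  Used to rule out class 0, since \<open>y_bound\<close> is at least 1 by definition.\<close>

lemma order_eq_p_if_rad_trivial:
  assumes tp: "m \<in> C" "lev m = s" and unique: "\<And>c. c \<in> C \<Longrightarrow> lev c = s \<Longrightarrow> c = m"
    and rad0: "rad = {\<zero>\<^bsub>E\<^esub>}"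
  shows "order G = p"
proof -
  have bm: "b m \<in> carrier G" using b_carrier tp by simp
  have \<kappa>_pow: "[\<kappa> m (b m [^] k) = k] (mod Q m)" for k :: int
    using cong_trans[OF \<kappa>_int_pow[OF tp(1) bm] cong_scalar_left[OF \<kappa>_b[OF tp(1,1)]], of k] by simp
  have "scalar (int p) = \<zero>\<^bsub>E\<^esub>" using scalar_in_rad[of "int p"] rad0 by simp
  then have "b m [^] int p = \<one>"
    using bm by (metis End_ring_apply(4) scalar_apply)
  then have "[\<kappa> m \<one> = int p] (mod Q m)" using \<kappa>_pow[of "int p"] by simp
  then have "Q m dvd int p ^ 1" using \<kappa>_one[OF tp(1)] by (metis cong_0_iff cong_dvd_iff power_one_right)
  then have ns: "n s = 1"
    using n_pos[OF tp(1)] unfolding p_power_dvd_iff tp(2) by simp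
  have "s = 1"
  proof (rule ccontr)
    assume "s \<noteq> 1"
    then have "n 1 < n s" using s_ge_1 by (intro strict_mono_onD[OF n_mono]) auto
    then show False using ns n1_pos by simp
  qed
  then have C: "c = m" if "c \<in> C" for c using lev_in[OF that] that unique by simp
  have Qm: "Q m = int p" using tp ns by simp
  have "bij_betw (\<lambda>k. b m [^] k) {0..<int p} (carrier G)"
  proof (rule bij_betw_byWitness[where f' = "\<lambda>x. \<kappa> m x mod int p"])
    show "\<forall>k\<in>{0..<int p}. \<kappa> m (b m [^] k) mod int p = k"
      using \<kappa>_pow unfolding Qm by (simp add: cong_def)
    show "\<forall>x\<in>carrier G. b m [^] (\<kappa> m x mod int p) = x"
    proof
      fix x assume x: "x \<in> carrier G"
      show "b m [^] (\<kappa> m x mod int p) = x"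
      proof (rule eq_if_\<kappa>_cong)
        fix c assume "c \<in> C"
        then have "c = m" using C by blast
        then show "[\<kappa> c (b m [^] (\<kappa> m x mod int p)) = \<kappa> c x] (mod Q c)"
          using \<kappa>_pow[of "\<kappa> m x mod int p"] unfolding Qm by (simp add: cong_def Qm)
      qed (use bm x in auto)
    qed
  qed (use bm p_gt_1 in auto)
  then have "card {0..<int p} = card (carrier G)" by (rule bij_betw_same_card)
  then show ?thesis by (simp add: order_def)
qed

theorem nilpotency_class_eq_y_bound:
  assumes uas: "uas_ucs_Delta G" and ord: "order G \<noteq> p"
    and tp: "m \<in> C" "lev m = s" and unique: "\<And>c. c \<in> C \<Longrightarrow> lev c = s \<Longrightarrow> c = m"
  shows "nilpotency_class (Delta G) = y_bound n s"
proof -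
  have pos: "0 < nilpotency_class (Delta G)"
    using order_eq_p_if_rad_trivial[OF tp unique] ord nilpotency_class_0_iff by auto
  have "y_bound n s = (LEAST t. 1 \<le> t \<and> covered t)"
    using covered_iff_f_rad[OF tp unique] by (simp add: y_bound_def)
  also have "\<dots> = nilpotency_class (Delta G)"
    using covered_nilpotency_class[OF uas pos] not_covered_below_nilpotency_class[OF uas] pos
    by (intro Least_equality) (auto simp: not_less[symmetric])
  finally show ?thesis by simp
qed

end

section \<open>Coordinates of a direct sum of cyclic groups\<close>

text \<open>Basis elements are indexed by a level and a position on it. Coordinates are read through
  the two given isomorphisms, and the basis consists of the preimages of unit vectors.\<close>

lemma p_group_basis_of_sum_group:
  fixes G :: "('g, 'm) monoid_scheme"
    and Gs :: "nat \<Rightarrow> ('a, 'k) monoid_scheme"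
    and R :: "nat \<Rightarrow> 'b set"
  assumes "Factorial_Ring.prime p" and G: "comm_group G"
    and "1 \<le> s" and "0 < n 1" and mono: "strict_mono_on {1..s} n"
    and R: "\<And>i. i \<in> {1..s} \<Longrightarrow> R i \<noteq> {}"
    and Gs: "\<And>i. i \<in> {1..s} \<Longrightarrow> comm_group (Gs i)"
    and iso_i: "\<And>i. i \<in> {1..s} \<Longrightarrow> Gs i \<cong> sum_group (R i) (\<lambda>_. integer_mod_group (p ^ n i))"
    and iso: "G \<cong> sum_group {1..s} Gs"
  shows "\<exists>\<kappa> b. p_group_basis G p s n (Sigma {1..s} R) fst \<kappa> b"
proof -
  interpret comm_group G by fact
  let ?S = "sum_group {1..s} Gs"
  let ?T = "\<lambda>i. sum_group (R i) (\<lambda>_. integer_mod_group (p ^ n i))"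
  have grp: "group (Gs i)" if "i \<in> {1..s}" for i using Gs[OF that] by (simp add: comm_group.axioms)
  have p1: "1 < p" using prime_gt_1_nat[OF assms(1)] .
  have n_pos: "0 < n i" if "i \<in> {1..s}" for i
    using strict_mono_on_leD[OF mono, of 1 i] that assms(3,4) by auto
  have S_grp: "group ?S" by (rule sum_group) (rule grp)
  have T_grp: "group (?T i)" for i by simp
  have S_carr: "carrier ?S = {x \<in> \<Pi>\<^sub>E i\<in>{1..s}. carrier (Gs i). finite {i \<in> {1..s}. x i \<noteq> \<one>\<^bsub>Gs i\<^esub>}}"
    using grp by (rule carrier_sum_group)
  have T_carr: "carrier (?T i) = {x \<in> \<Pi>\<^sub>E r\<in>R i. {0..<int (p ^ n i)}. finite {r \<in> R i. x r \<noteq> 0}}" for i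
    using p1 by (subst carrier_sum_group) (auto simp: carrier_integer_mod_group)
  obtain \<phi> where \<phi>: "\<phi> \<in> Group.iso G ?S" using iso by (auto simp: is_iso_def)
  obtain \<psi> where \<psi>: "\<And>i. i \<in> {1..s} \<Longrightarrow> \<psi> i \<in> Group.iso (Gs i) (?T i)"
    using bchoice[of "{1..s}" "\<lambda>i f. f \<in> Group.iso (Gs i) (?T i)"] iso_i
    unfolding is_iso_def ex_in_conv by blast
  interpret \<phi>: group_hom G ?S \<phi>
    using \<phi> S_grp by (simp add: group_hom_def group_hom_axioms_def is_group Group.iso_def)
  have \<psi>_hom: "group_hom (Gs i) (?T i) (\<psi> i)" if "i \<in> {1..s}" for i
    using \<psi>[OF that] grp[OF that] T_grp by (simp add: group_hom_def group_hom_axioms_def Group.iso_def)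
  have \<phi>_in: "\<phi> x i \<in> carrier (Gs i)" if "x \<in> carrier G" "i \<in> {1..s}" for x i
    using \<phi>.hom_closed[OF that(1)] that(2) unfolding S_carr by auto
  define \<kappa> where "\<kappa> = (\<lambda>(i, r) x. \<psi> i (\<phi> x i) r)"
  have \<psi>\<phi>_in: "\<psi> i (\<phi> x i) \<in> carrier (?T i)" if "x \<in> carrier G" "i \<in> {1..s}" for x i
    using group_hom.hom_closed[OF \<psi>_hom] \<phi>_in that by blast
  have \<kappa>_range: "\<kappa> (i, r) x \<in> {0..<int p ^ n i}" if "x \<in> carrier G" "i \<in> {1..s}" "r \<in> R i" for x i r
    using \<psi>\<phi>_in[OF that(1,2)] that(3) unfolding T_carr by (auto simp: \<kappa>_def)
  have dvd_iff: "int p ^ n i dvd \<kappa> (i, r) x \<longleftrightarrow> \<kappa> (i, r) x = 0"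
    if "x \<in> carrier G" "i \<in> {1..s}" "r \<in> R i" for x i r
    using \<kappa>_range[OF that] by (auto dest: zdvd_imp_le)
  define e where "e = (\<lambda>i r. \<lambda>r'\<in>R i. if r' = r then 1 else 0 :: int)"
  have e_in: "e i r \<in> carrier (?T i)" if "i \<in> {1..s}" for i r
  proof -
    have "(1::int) < int (p ^ n i)" using p1 n_pos[OF that] by (simp add: one_less_power)
    moreover have "finite {r' \<in> R i. e i r r' \<noteq> 0}"
      by (rule finite_subset[of _ "{r}"]) (auto simp: e_def)
    ultimately show ?thesis unfolding T_carr using p1 by (auto simp: e_def)
  qed
  define y where "y = (\<lambda>i r. \<lambda>j\<in>{1..s}. if j = i then inv_into (carrier (Gs i)) (\<psi> i) (e i r) else \<one>\<^bsub>Gs j\<^esub>)"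
  have \<psi>_inv: "inv_into (carrier (Gs i)) (\<psi> i) (e i r) \<in> carrier (Gs i)"
      "\<psi> i (inv_into (carrier (Gs i)) (\<psi> i) (e i r)) = e i r" if "i \<in> {1..s}" for i r
    using \<psi>[OF that] e_in[OF that, of r]
    by (auto simp: Group.iso_def bij_betw_def inv_into_into f_inv_into_f)
  have y_in: "y i r \<in> carrier ?S" if "i \<in> {1..s}" for i r
    unfolding S_carr using that \<psi>_inv[OF that] grp
    by (auto simp: y_def group.is_monoid monoid.one_closed)
  define b where "b = (\<lambda>(i, r). inv_into (carrier G) \<phi> (y i r))"
  have b_in: "b (i, r) \<in> carrier G" and \<phi>b: "\<phi> (b (i, r)) = y i r" if "i \<in> {1..s}" for i r
    using \<phi> y_in[OF that, of r]
    by (auto simp: b_def Group.iso_def bij_betw_def inv_into_into f_inv_into_f)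
  have "p_group_basis G p s n (Sigma {1..s} R) fst \<kappa> b"
  proof (intro p_group_basis.intro p_group_basis_axioms.intro)
    show "fst ` Sigma {1..s} R = {1..s}" unfolding fst_image_Sigma using R by blast
  next
    fix c assume "c \<in> Sigma {1..s} R"
    then show "b c \<in> carrier G" using b_in by auto
  next
    fix c x y assume c: "c \<in> Sigma {1..s} R" and x: "x \<in> carrier G" and y: "y \<in> carrier G"
    obtain i r where ir: "c = (i, r)" "i \<in> {1..s}" "r \<in> R i" using c by blast
    have "\<phi> (x \<otimes>\<^bsub>G\<^esub> y) i = \<phi> x i \<otimes>\<^bsub>Gs i\<^esub> \<phi> y i"
      using \<phi>.hom_mult[OF x y] ir by simp
    then have "\<psi> i (\<phi> (x \<otimes>\<^bsub>G\<^esub> y) i) = \<psi> i (\<phi> x i) \<otimes>\<^bsub>?T i\<^esub> \<psi> i (\<phi> y i)"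
      using group_hom.hom_mult[OF \<psi>_hom[OF ir(2)]] \<phi>_in x y ir by simp
    then have "\<kappa> c (x \<otimes>\<^bsub>G\<^esub> y) = (\<kappa> c x + \<kappa> c y) mod int (p ^ n i)"
      using ir by (simp add: \<kappa>_def)
    then show "[\<kappa> c (x \<otimes>\<^bsub>G\<^esub> y) = \<kappa> c x + \<kappa> c y] (mod int p ^ n (fst c))"
      using ir by (simp add: cong_def)
  next
    fix c d assume c: "c \<in> Sigma {1..s} R" and d: "d \<in> Sigma {1..s} R"
    obtain i r where ir: "c = (i, r)" "i \<in> {1..s}" "r \<in> R i" using c by blast
    obtain j q where jq: "d = (j, q)" "j \<in> {1..s}" "q \<in> R j" using d by blast
    have "\<kappa> c (b d) = (if c = d then 1 else 0)"
    proof (cases "i = j")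
      case True
      then show ?thesis using ir jq \<phi>b[OF jq(2)] \<psi>_inv(2)[OF jq(2)] by (simp add: \<kappa>_def y_def e_def)
    next
      case False
      then show ?thesis
        using ir jq \<phi>b[OF jq(2)] group_hom.hom_one[OF \<psi>_hom[OF ir(2)]] by (simp add: \<kappa>_def y_def)
    qed
    then show "[\<kappa> c (b d) = (if c = d then 1 else 0)] (mod int p ^ n (fst c))" by simp
  next
    fix x assume x: "x \<in> carrier G"
    have "finite (Sigma {1..s} (\<lambda>i. {r \<in> R i. \<psi> i (\<phi> x i) r \<noteq> 0}))"
      using \<psi>\<phi>_in[OF x] unfolding T_carr by (intro finite_SigmaI) auto
    then show "finite {c \<in> Sigma {1..s} R. \<not> int p ^ n (fst c) dvd \<kappa> c x}"
      by (rule finite_subset[rotated]) (auto simp: \<kappa>_def)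
  next
    fix x assume x: "x \<in> carrier G"
      and zero: "\<And>c. c \<in> Sigma {1..s} R \<Longrightarrow> int p ^ n (fst c) dvd \<kappa> c x"
    have "\<phi> x i = \<one>\<^bsub>Gs i\<^esub>" if i: "i \<in> {1..s}" for i
    proof -
      have "\<psi> i (\<phi> x i) r = 0" if "r \<in> R i" for r
        using zero[of "(i, r)"] dvd_iff[OF x i that] i that by (simp add: \<kappa>_def)
      then have "\<psi> i (\<phi> x i) = \<one>\<^bsub>?T i\<^esub>"
        using \<psi>\<phi>_in[OF x i] unfolding T_carr by (auto simp: fun_eq_iff PiE_def extensional_def)
      then have "\<psi> i (\<phi> x i) = \<psi> i \<one>\<^bsub>Gs i\<^esub>" using group_hom.hom_one[OF \<psi>_hom[OF i]] by simp
      then show ?thesis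
        using \<psi>[OF i] \<phi>_in[OF x i] group.is_monoid[OF grp[OF i]]
        by (auto simp: Group.iso_def bij_betw_def inj_on_def monoid.one_closed)
    qed
    then have "\<phi> x = \<one>\<^bsub>?S\<^esub>"
      using \<phi>.hom_closed[OF x] unfolding S_carr by (auto simp: fun_eq_iff PiE_def extensional_def)
    then have "\<phi> x = \<phi> \<one>\<^bsub>G\<^esub>" by simp
    then show "x = \<one>\<^bsub>G\<^esub>"
      using \<phi> x by (auto simp: Group.iso_def bij_betw_def inj_on_def)
  qed (use assms in simp_all)
  then show ?thesis by blast
qed

text \<open>Infinite sets have \<open>card\<close> 0, so the case r_s at least 2 needs the extra
  disjunct. Excluding order p keeps the class positive when r_s is 1; for the group of order p the
  class is 0 and \<open>y_bound n s\<close> is 1.\<close>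

theorem theorem6p5:
  fixes G :: "('g, 'm) monoid_scheme"
    and Gs :: "nat \<Rightarrow> ('a, 'k) monoid_scheme"
    and R :: "nat \<Rightarrow> 'b set"
    and n :: "nat \<Rightarrow> nat"
    and p s :: nat
  assumes "Factorial_Ring.prime p"
    and "comm_group G"
    and "1 \<le> s"
    and "0 < n 1" and "strict_mono_on {1..s} n"
    and "\<And>i. i \<in> {1..s} \<Longrightarrow> R i \<noteq> {}"
    and "\<And>i. i \<in> {1..s} \<Longrightarrow> comm_group (Gs i)"
    and "\<And>i. i \<in> {1..s} \<Longrightarrow> Gs i \<cong> sum_group (R i) (\<lambda>_. integer_mod_group (p ^ n i))"
    and "G \<cong> sum_group {1..s} Gs"
    and "order G \<noteq> p"
    and "uas_ucs_Delta G"
  shows "(infinite (R s) \<or> 2 \<le> card (R s) \<longrightarrow>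
            nilpotency_class (Delta G) = annihilating_length (End_ring G) (End_radical G))
       \<and> (card (R s) = 1 \<longrightarrow> nilpotency_class (Delta G) = y_bound n s)"
proof -
  obtain \<kappa> b where "p_group_basis G p s n (Sigma {1..s} R) fst \<kappa> b"
    using p_group_basis_of_sum_group[OF assms(1-9)] by blast
  then interpret p_group_basis G p s n "Sigma {1..s} R" fst \<kappa> b .
  have s: "s \<in> {1..s}" using assms(3) by simp
  show ?thesis
  proof (intro conjI impI)
    assume many: "infinite (R s) \<or> 2 \<le> card (R s)"
    have "\<exists>r\<in>R s. \<exists>r'\<in>R s. r \<noteq> r'"
    proof (rule ccontr)
      assume "\<not> ?thesis"
      then have "\<exists>r. R s \<subseteq> {r}" by blast
      then obtain r where r: "R s \<subseteq> {r}" ..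
      then have "finite (R s)" "card (R s) \<le> 1" using finite_subset card_mono[of "{r}" "R s"] by auto
      then show False using many by simp
    qed
    then obtain r r' where "r \<in> R s" "r' \<in> R s" "r \<noteq> r'" by blast
    then show "nilpotency_class (Delta G) = annihilating_length (End_ring G) (End_radical G)"
      unfolding jacobson_radical_eq_rad
      using s by (intro nilpotency_class_eq_annihilating_length[OF assms(11), of "(s, r)" "(s, r')"]) auto
  next
    assume "card (R s) = 1"
    then obtain r where "R s = {r}" by (rule card_1_singletonE)
    then show "nilpotency_class (Delta G) = y_bound n s"
      using s by (intro nilpotency_class_eq_y_bound[OF assms(11,10), of "(s, r)"]) fastforce+
  qed
qed

end
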